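(* Let $\alpha>-\frac12$. For every $f\in\mathcal{D}_q(\mathbb{R}_q)$ and every $\lambda\in\mathbb{R}_q$, $$F_D^{\alpha,q}(f)(\lambda)=\big[{}^tV_{\alpha,q}(f)\big]^{\widehat{\ }}(\lambda;q^2),$$ that is, the $q$-Dunkl transform of $f$ is the $q^2$-analogue Fourier transform of ${}^tV_{\alpha,q}(f)$.
   Context: Standing assumptions: $q\in(0,1)$ and $\frac{\log(1-q)}{\log q}\in 2\mathbb{Z}$. Functions are complex-valued. $\mathbb{R}_q=\{\pm q^n: n\in\mathbb{Z}\}$. Notation: $(a;q)_\infty=\prod_{k\ge0}(1-aq^k)$, $[x]_q=\frac{1-q^x}{1-q}$, $[n]_q!=\prod_{k=1}^n[k]_q$, $\Gamma_{q^2}(x)=\frac{(q^2;q^2)_\infty}{(q^{2x};q^2)_\infty}(1-q^2)^{1-x}$, $c_{\alpha,q}=\frac{(1+q)^{-\alpha}}{\Gamma_{q^2}(\alpha+1)}$, $K=\frac{(1+q)^{1/2}}{2\Gamma_{q^2}(1/2)}$. $q$-Jackson integral: $\int_{-\infty}^{\infty}f(x)\,d_qx=(1-q)\sum_{n\in\mathbb{Z}}q^n[f(q^n)+f(-q^n)]$; and for $a\in\{q^n:n\in\mathbb{Z}\}$, $\int_a^\infty f(x)d_qx=(1-q)a\sum_{n=-\infty}^{-1}q^nf(aq^n)$. For $z\neq0$, $\partial_q f(z)=\frac{f(q^{-1}z)+f(-q^{-1}z)-f(qz)+f(-qz)-2f(-z)}{2(1-q)z}$. $\mathcal{E}_q(\mathbb{R}_q)$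 is the space of functions $f$ on $\mathbb{R}_q$ such that for all $n\in\mathbb{N}$, $a\ge0$, $\sup\{|\partial_q^kf(x)|:0\le k\le n,\ x\in[-a,a]\cap\mathbb{R}_q\}<\infty$ and $\lim_{x\to0,x\in\mathbb{R}_q}\partial_q^nf(x)$ exists. $\mathcal{D}_q(\mathbb{R}_q)$ is the space of $f\in\mathcal{E}_q(\mathbb{R}_q)$ with compact support, i.e. vanishing for $|x|$ large. $j_\alpha(x;q^2)=\sum_{n\ge0}(-1)^n\frac{\Gamma_{q^2}(\alpha+1)q^{n(n+1)}}{\Gamma_{q^2}(\alpha+n+1)\Gamma_{q^2}(n+1)}\left(\frac{x}{1+q}\right)^{2n}$, $\psi_\lambda^{\alpha,q}(x)=j_\alpha(\lambda x;q^2)+\frac{i\lambda x}{[2\alpha+2]_q}j_{\alpha+1}(\lambda x;q^2)$. $q$-Dunkl transform: $F_D^{\alpha,q}(f)(\lambda)=\frac{c_{\alpha,q}}{2}\int_{-\infty}^{+\infty}f(x)\psi_{-\lambda}^{\alpha,q}(x)|x|^{2\alpha+1}d_qx$. $q$-exponential: $\cos(x;q^2)=\sum_{n\ge0}(-1)^nq^{n(n+1)}\frac{x^{2n}}{[2n]_q!}$, $\sin(x;q^2)=\sum_{n\ge0}(-1)^nq^{n(n+1)}\frac{x^{2n+1}}{[2n+1]_q!}$, $e(z;q^2)=\cos(-iz;q^2)+i\sin(-iz;q^2)$. $q^2$-analogue Fourier transform: $\widehat f(\lambda;q^2)=K\int_{-\infty}^\infty f(t)e(-it\lambda;q^2)d_qt$.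 $W_\alpha(t;q^2)=\frac{(t^2q^2;q^2)_\infty}{(t^2q^{2\alpha+1};q^2)_\infty}$. Dual intertwining operator: for $f\in\mathcal{D}_q(\mathbb{R}_q)$, $t\in\mathbb{R}_q$, $${}^tV_{\alpha,q}(f)(t)=\frac{(1+q)^{-\alpha+\frac12}}{2\Gamma_{q^2}(\alpha+\frac12)}\int_{|x|\ge q|t|}W_\alpha\!\left(\tfrac tx;q^2\right)\left(1+\tfrac tx\right)f(x)|x|^{2\alpha}d_qx,$$ where $\int_{|x|\ge q|t|}g(x)d_qx=\int_{q|t|}^\infty[g(x)+g(-x)]d_qx$ (by the convention above, the sum runs over $x\in\mathbb{R}_q$ with $|x|\ge|t|$). *)

theory Defs
  imports "HOL-Analysis.Analysis"
begin

text \<open>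
  Functions on \<open>R\<^sub>q = {q\<^sup>n, -q\<^sup>n. n \<in> \<int>}\<close> are represented by functions on all of \<open>real\<close>;
  evaluated at points of \<open>R\<^sub>q\<close>, the notions below do not depend on values outside \<open>R\<^sub>q\<close>. The base \<open>q\<close> is an explicit
  parameter throughout, and the definitions are meant for \<open>0 < q < 1\<close>.
\<close>

definition Rq :: "real \<Rightarrow> real set" where
  "Rq q = {x. \<exists>n::int. x = q powi n \<or> x = - (q powi n)}"

definition q_pochhammer_inf :: "real \<Rightarrow> real \<Rightarrow> real" where
  "q_pochhammer_inf a p = (\<Prod>k. 1 - a * p ^ k)"

definition q_number :: "real \<Rightarrow> real \<Rightarrow> real" where
  "q_number q x = (1 - q powr x) / (1 - q)"

definition q_fact :: "real \<Rightarrow> nat \<Rightarrow> real" where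
  "q_fact q n = (\<Prod>k=1..n. q_number q (real k))"

text \<open>The \<open>q\<^sup>2\<close>-Gamma function \<open>\<Gamma>(x)\<close> with base \<open>q\<^sup>2\<close>, as a function of \<open>q\<close>.\<close>

definition Gamma_q2 :: "real \<Rightarrow> real \<Rightarrow> real" where
  "Gamma_q2 q x =
     q_pochhammer_inf (q\<^sup>2) (q\<^sup>2) / q_pochhammer_inf (q powr (2 * x)) (q\<^sup>2)
       * (1 - q\<^sup>2) powr (1 - x)"

definition c_const :: "real \<Rightarrow> real \<Rightarrow> real" where
  "c_const q \<alpha> = (1 + q) powr (- \<alpha>) / Gamma_q2 q (\<alpha> + 1)"

definition K_const :: "real \<Rightarrow> real" where
  "K_const q = (1 + q) powr (1 / 2) / (2 * Gamma_q2 q (1 / 2))"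

definition jackson_integral :: "real \<Rightarrow> (real \<Rightarrow> complex) \<Rightarrow> complex" where
  "jackson_integral q f =
     of_real (1 - q)
       * (\<Sum>\<^sub>\<infinity>n\<in>(UNIV::int set). of_real (q powi n) * (f (q powi n) + f (- (q powi n))))"

text \<open>The integral from \<open>a\<close> to infinity; the point \<open>a\<close> itself (index \<open>n = 0\<close>) is not included.\<close>

definition jackson_integral_from :: "real \<Rightarrow> real \<Rightarrow> (real \<Rightarrow> complex) \<Rightarrow> complex" where
  "jackson_integral_from q a f =
     of_real ((1 - q) * a) * (\<Sum>\<^sub>\<infinity>n\<in>{..-1::int}. of_real (q powi n) * f (a * q powi n))"

definition q_deriv :: "real \<Rightarrow> (real \<Rightarrow> complex) \<Rightarrow> real \<Rightarrow> complex" where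
  "q_deriv q f z =
     (f (inverse q * z) + f (- inverse q * z) - f (q * z) + f (- q * z) - 2 * f (- z))
       / of_real (2 * (1 - q) * z)"

definition Eq_space :: "real \<Rightarrow> (real \<Rightarrow> complex) set" where
  "Eq_space q = {f. \<forall>n.
     (\<forall>a\<ge>0. bdd_above {cmod ((q_deriv q ^^ k) f x) | k x. k \<le> n \<and> x \<in> {-a..a} \<inter> Rq q})
     \<and> (\<exists>l. ((q_deriv q ^^ n) f \<longlongrightarrow> l) (at 0 within Rq q))}"

definition Dq_space :: "real \<Rightarrow> (real \<Rightarrow> complex) set" where
  "Dq_space q = {f \<in> Eq_space q. \<exists>b. \<forall>x\<in>Rq q. \<bar>x\<bar> > b \<longrightarrow> f x = 0}"

definition q_bessel_j :: "real \<Rightarrow> real \<Rightarrow> complex \<Rightarrow> complex" where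
  "q_bessel_j q \<alpha> x =
     (\<Sum>n. (- 1) ^ n
       * of_real (Gamma_q2 q (\<alpha> + 1) * q ^ (n * (n + 1))
           / (Gamma_q2 q (\<alpha> + real n + 1) * Gamma_q2 q (real n + 1)))
       * (x / of_real (1 + q)) ^ (2 * n))"

definition q_dunkl_kernel :: "real \<Rightarrow> real \<Rightarrow> complex \<Rightarrow> real \<Rightarrow> complex" where
  "q_dunkl_kernel q \<alpha> l x =
     q_bessel_j q \<alpha> (l * of_real x)
     + \<i> * l * of_real x / of_real (q_number q (2 * \<alpha> + 2)) * q_bessel_j q (\<alpha> + 1) (l * of_real x)"

definition q_dunkl_transform ::
  "real \<Rightarrow> real \<Rightarrow> (real \<Rightarrow> complex) \<Rightarrow> real \<Rightarrow> complex" where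
  "q_dunkl_transform q \<alpha> f l =
     of_real (c_const q \<alpha> / 2)
       * jackson_integral q
           (\<lambda>x. f x * q_dunkl_kernel q \<alpha> (- of_real l) x * of_real (\<bar>x\<bar> powr (2 * \<alpha> + 1)))"

definition q_cos :: "real \<Rightarrow> complex \<Rightarrow> complex" where
  "q_cos q z = (\<Sum>n. (- 1) ^ n * of_real (q ^ (n * (n + 1))) * z ^ (2 * n)
                      / of_real (q_fact q (2 * n)))"

definition q_sin :: "real \<Rightarrow> complex \<Rightarrow> complex" where
  "q_sin q z = (\<Sum>n. (- 1) ^ n * of_real (q ^ (n * (n + 1))) * z ^ (2 * n + 1)
                      / of_real (q_fact q (2 * n + 1)))"

definition q_exp :: "real \<Rightarrow> complex \<Rightarrow> complex" where
  "q_exp q z = q_cos q (- \<i> * z) + \<i> * q_sin q (- \<i> * z)"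

definition q2_fourier :: "real \<Rightarrow> (real \<Rightarrow> complex) \<Rightarrow> real \<Rightarrow> complex" where
  "q2_fourier q f l =
     of_real (K_const q)
       * jackson_integral q (\<lambda>t. f t * q_exp q (- \<i> * of_real t * of_real l))"

definition W_kernel :: "real \<Rightarrow> real \<Rightarrow> real \<Rightarrow> real" where
  "W_kernel q \<alpha> t =
     q_pochhammer_inf (t\<^sup>2 * q\<^sup>2) (q\<^sup>2) / q_pochhammer_inf (t\<^sup>2 * q powr (2 * \<alpha> + 1)) (q\<^sup>2)"

text \<open>
  Starting at \<open>q * \<bar>t\<bar>\<close> makes the sum below range over the \<open>x \<in> R\<^sub>q\<close> with \<open>\<bar>x\<bar> \<ge> \<bar>t\<bar>\<close>,
  when \<open>t \<in> R\<^sub>q\<close>.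
\<close>

definition dual_intertwining ::
  "real \<Rightarrow> real \<Rightarrow> (real \<Rightarrow> complex) \<Rightarrow> real \<Rightarrow> complex" where
  "dual_intertwining q \<alpha> f t =
     (let g = (\<lambda>x. of_real (W_kernel q \<alpha> (t / x) * (1 + t / x)) * f x
                   * of_real (\<bar>x\<bar> powr (2 * \<alpha>)))
      in of_real ((1 + q) powr (- \<alpha> + 1 / 2) / (2 * Gamma_q2 q (\<alpha> + 1 / 2)))
           * jackson_integral_from q (q * \<bar>t\<bar>) (\<lambda>x. g x + g (- x)))"

end

(*
  Writing both sides as sums over x in R_q and interchanging the order of summation reduces the
  theorem to a Sonine-type formula for the q-Dunkl kernel,
    c * psi(x) = const * sum over k of q^k W(q^k) (cos(q^k x l) - i q^k sin(q^k x l)).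
  Comparing power series in x, this is the q-beta integral, i.e. the q-binomial theorem
    sum over k of (a;p)_k / (p;p)_k z^k = (az;p)_inf / (z;p)_inf,   p = q^2,
  together with the duplication formula for the q-Gamma function. The q-binomial theorem follows by
  iterating (1 - z) F(z) = (1 - a z) F(p z).
*)
theory Submission
  imports Defs
begin

section \<open>The \<open>q\<close>-binomial theorem\<close>

text \<open>Put t = s * x * q^k with s = 1 or s = -1 and x = q^n. W is even but 1 + t/x is not, so
  the kernel formula appears only after the terms of t and -t are added: the parity of cosine and
  sine then removes the cross terms and leaves twice cos - i q^k sin for f(x), and its
  conjugate-sign version for f(-x). Hence the two signs are folded together before the sum over k is
  evaluated. The interchange rests on absolute convergence: W(q^k) is bounded in k, f is bounded and
  vanishes at q^n and -q^n for n < N, the exponential is bounded on the bounded set of t that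
  remains, and the powers of x combine to q^((2\<alpha>+2) n). So a product of two geometric series
  dominates the double series. The constant written D below is the moment sum over k of q^k W(q^k),
  that is, the value of the cosine formula at x = 0.\<close>

lemma q_pochhammer_inf_has_prod:
  assumes "0 \<le> p" "p < 1"
  shows "(\<lambda>k. 1 - a * p ^ k) has_prod q_pochhammer_inf a p"
proof -
  have "summable (\<lambda>k. norm ((1 - a * p ^ k) - 1))"
    using assms by (simp add: abs_mult power_abs summable_geometric summable_mult)
  hence "convergent_prod (\<lambda>k. 1 - a * p ^ k)"
    by (intro abs_convergent_prod_imp_convergent_prod summable_imp_abs_convergent_prod)
  thus ?thesis
    unfolding q_pochhammer_inf_def by (rule convergent_prod_has_prod)
qed

lemma q_pochhammer_inf_factor_bounds:
  fixes a p :: real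
  assumes "0 \<le> p" "p < 1" "0 \<le> a" "a < 1"
  shows "0 < 1 - a * p ^ k" "1 - a * p ^ k \<le> 1"
proof -
  have "a * p ^ k \<le> a * 1"
    using assms by (intro mult_left_mono power_le_one) auto
  thus "0 < 1 - a * p ^ k" using assms by simp
  show "1 - a * p ^ k \<le> 1" using assms by simp
qed

lemma q_pochhammer_inf_pos:
  assumes "0 \<le> p" "p < 1" "0 \<le> a" "a < 1"
  shows "0 < q_pochhammer_inf a p"
  using has_prod_pos[OF q_pochhammer_inf_has_prod[OF assms(1,2)]]
    q_pochhammer_inf_factor_bounds[OF assms] by blast

lemma q_pochhammer_inf_le_1:
  assumes "0 \<le> p" "p < 1" "0 \<le> a" "a < 1"
  shows "q_pochhammer_inf a p \<le> 1"
  by (rule has_prod_le[OF q_pochhammer_inf_has_prod[OF assms(1,2)] has_prod_one])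
     (use q_pochhammer_inf_factor_bounds[OF assms] in \<open>auto intro: less_imp_le\<close>)

lemma q_pochhammer_inf_antimono:
  assumes "0 \<le> p" "p < 1" "0 \<le> b" "b \<le> a" "a < 1"
  shows "q_pochhammer_inf a p \<le> q_pochhammer_inf b p"
proof (rule has_prod_le[OF q_pochhammer_inf_has_prod[OF assms(1,2)] q_pochhammer_inf_has_prod[OF assms(1,2)]])
  fix k
  have "b * p ^ k \<le> a * p ^ k"
    using assms by (intro mult_right_mono) auto
  thus "0 \<le> 1 - a * p ^ k \<and> 1 - a * p ^ k \<le> 1 - b * p ^ k"
    using q_pochhammer_inf_factor_bounds(1)[of p a k] assms by auto
qed

lemma q_pochhammer_inf_rec:
  assumes "0 \<le> p" "p < 1" "a \<noteq> 1"
  shows "q_pochhammer_inf a p = (1 - a) * q_pochhammer_inf (a * p) p"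
proof -
  have "(\<lambda>k. 1 - a * p ^ Suc k) has_prod q_pochhammer_inf (a * p) p"
    using q_pochhammer_inf_has_prod[OF assms(1,2), of "a * p"] by (simp add: mult_ac)
  hence "(\<lambda>k. 1 - a * p ^ k) has_prod (q_pochhammer_inf (a * p) p * (1 - a * p ^ 0))"
    by (rule has_prod_Suc_imp)
  thus ?thesis
    using has_prod_unique2[OF q_pochhammer_inf_has_prod[OF assms(1,2), of a]] by (simp add: mult_ac)
qed

text \<open>The equation only links the values of F along the orbit p^N z; continuity at 0 supplies
  the limit of F (p^N z) and so determines F z. Keeping the products multiplied out on both sides
  avoids any division during the iteration.\<close>

lemma q_functional_equation_solution:
  fixes F :: "real \<Rightarrow> real"
  assumes p: "0 < p" "p < 1" and z: "0 \<le> z" "z < 1"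
    and F: "\<And>x. 0 \<le> x \<Longrightarrow> x < 1 \<Longrightarrow> (1 - x) * F x = (1 - a * x) * F (p * x)"
    and cont: "isCont F 0"
  shows "q_pochhammer_inf z p * F z = q_pochhammer_inf (a * z) p * F 0"
proof -
  have iter: "(\<Prod>i<N. 1 - z * p ^ i) * F z = (\<Prod>i<N. 1 - (a * z) * p ^ i) * F (p ^ N * z)" for N
  proof (induction N)
    case (Suc N)
    have "p ^ N * z \<le> 1 * z"
      using p z by (intro mult_right_mono power_le_one) auto
    hence "(1 - p ^ N * z) * F (p ^ N * z) = (1 - a * (p ^ N * z)) * F (p * (p ^ N * z))"
      using p z by (intro F) auto
    hence step: "(1 - z * p ^ N) * F (p ^ N * z) = (1 - (a * z) * p ^ N) * F (p ^ Suc N * z)"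
      by (simp add: mult_ac)
    have "(\<Prod>i<Suc N. 1 - z * p ^ i) * F z = (1 - z * p ^ N) * ((\<Prod>i<N. 1 - z * p ^ i) * F z)"
      by simp
    also have "\<dots> = (\<Prod>i<N. 1 - (a * z) * p ^ i) * ((1 - z * p ^ N) * F (p ^ N * z))"
      unfolding Suc by (simp only: mult_ac)
    also have "\<dots> = (\<Prod>i<Suc N. 1 - (a * z) * p ^ i) * F (p ^ Suc N * z)"
      unfolding step by simp
    finally show ?case .
  qed simp
  have "(\<lambda>N. p ^ N * z) \<longlonglongrightarrow> 0 * z"
    using p by (intro tendsto_intros LIMSEQ_realpow_zero) auto
  hence "(\<lambda>N. F (p ^ N * z)) \<longlonglongrightarrow> F 0"
    by (intro isCont_tendsto_compose[OF cont]) simp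
  hence "(\<lambda>N. (\<Prod>i<N. 1 - (a * z) * p ^ i) * F (p ^ N * z)) \<longlonglongrightarrow> q_pochhammer_inf (a * z) p * F 0"
    using p by (intro tendsto_mult has_prod_imp_tendsto' q_pochhammer_inf_has_prod) auto
  moreover have "(\<lambda>N. (\<Prod>i<N. 1 - z * p ^ i) * F z) \<longlonglongrightarrow> q_pochhammer_inf z p * F z"
    using p by (intro tendsto_mult tendsto_const has_prod_imp_tendsto' q_pochhammer_inf_has_prod) auto
  ultimately show ?thesis
    using LIMSEQ_unique by (simp add: iter)
qed

text \<open>The quotient of tails equals (a;p)_k / (p;p)_k up to the factor (p;p)_inf / (a;p)_inf,
  which does not depend on k. A bound uniform in k gives convergence for |z| < 1 and later dominates
  the double sums.\<close>

lemma q_binomial_weight_bounds: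
  assumes p: "0 < p" "p < 1" and a: "0 \<le> a" "a < 1"
  shows "0 \<le> q_pochhammer_inf (p * p ^ k) p / q_pochhammer_inf (a * p ^ k) p"
    and "q_pochhammer_inf (p * p ^ k) p / q_pochhammer_inf (a * p ^ k) p \<le> 1 / q_pochhammer_inf a p"
proof -
  have pk: "0 \<le> p * p ^ k" "p * p ^ k < 1"
    using p power_Suc_less_one[of p k] by auto
  have ak: "0 \<le> a * p ^ k" "a * p ^ k \<le> a"
    using p a by (auto simp: mult_left_le power_le_one)
  show "0 \<le> q_pochhammer_inf (p * p ^ k) p / q_pochhammer_inf (a * p ^ k) p"
    using q_pochhammer_inf_pos[of p "p * p ^ k"] q_pochhammer_inf_pos[of p "a * p ^ k"] p a pk ak by simp
  show "q_pochhammer_inf (p * p ^ k) p / q_pochhammer_inf (a * p ^ k) p \<le> 1 / q_pochhammer_inf a p"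
    using p a pk ak
    by (intro frac_le q_pochhammer_inf_le_1 q_pochhammer_inf_pos q_pochhammer_inf_antimono) auto
qed

text \<open>The coefficients are written as tails of infinite products because W(q^k) has literally
  this form, with p = q^2 and a = q^(2\<alpha>+1); this is the source of the extra factor (p;p)_inf
  / (a;p)_inf in the sum.\<close>

lemma q_binomial_theorem:
  assumes p: "0 < p" "p < 1" and a: "0 \<le> a" "a < 1" and z: "0 \<le> z" "z < 1"
  shows "(\<lambda>k. q_pochhammer_inf (p * p ^ k) p / q_pochhammer_inf (a * p ^ k) p * z ^ k) sums
    (q_pochhammer_inf p p * q_pochhammer_inf (a * z) p / (q_pochhammer_inf a p * q_pochhammer_inf z p))"
proof -
  define w where "w = (\<lambda>k. q_pochhammer_inf (p * p ^ k) p / q_pochhammer_inf (a * p ^ k) p)"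
  define F where "F = (\<lambda>x. \<Sum>k. w k * x ^ k)"
  have summ: "summable (\<lambda>k. w k * x ^ k)" if "\<bar>x\<bar> < 1" for x
  proof (rule summable_comparison_test')
    show "summable (\<lambda>k. 1 / q_pochhammer_inf a p * \<bar>x\<bar> ^ k)"
      using that by (intro summable_mult summable_geometric) auto
    show "norm (w k * x ^ k) \<le> 1 / q_pochhammer_inf a p * \<bar>x\<bar> ^ k" for k
    proof -
      have "0 \<le> w k" "w k \<le> 1 / q_pochhammer_inf a p"
        unfolding w_def by (rule q_binomial_weight_bounds[OF p a])+
      thus ?thesis
        by (simp add: abs_mult power_abs mult_right_mono del: times_divide_eq_left)
    qed
  qed
  \<comment> \<open>Peeling one factor off each infinite product gives a two-term recurrence, which
    is the functional equation of F read coefficient by coefficient.\<close>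
  have wrec: "w (Suc k) * (1 - p ^ Suc k) = w k * (1 - a * p ^ k)" for k
  proof -
    have lt: "p * p ^ k < 1" "a * p ^ k < 1"
      using p a power_Suc_less_one[of p k] q_pochhammer_inf_factor_bounds(1)[of p a k] by auto
    have "q_pochhammer_inf (p * p ^ k) p = (1 - p ^ Suc k) * q_pochhammer_inf (p * p ^ Suc k) p"
      using q_pochhammer_inf_rec[of p "p * p ^ k"] p lt by (simp add: mult_ac)
    moreover have "q_pochhammer_inf (a * p ^ k) p = (1 - a * p ^ k) * q_pochhammer_inf (a * p ^ Suc k) p"
      using q_pochhammer_inf_rec[of p "a * p ^ k"] p lt by (simp add: mult_ac)
    ultimately show ?thesis
      using lt unfolding w_def by simp
  qed
  have feq: "(1 - x) * F x = (1 - a * x) * F (p * x)" if x: "0 \<le> x" "x < 1" for x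
  proof -
    have px: "\<bar>p * x\<bar> < 1"
      using p x mult_strict_mono[of p 1 x 1] by (cases "x = 0") (auto simp: abs_mult)
    have s: "(\<lambda>k. w k * x ^ k) sums F x" "(\<lambda>k. w k * (p * x) ^ k) sums F (p * x)"
      unfolding F_def using summ[of x] summ[OF px] x by (auto simp: summable_sums)
    have "(\<lambda>k. w k * x ^ k - w k * (p * x) ^ k) sums (F x - F (p * x))"
      by (rule sums_diff[OF s])
    \<comment> \<open>The terms at index 0 cancel, so the series may be shifted by one and
      \<open>wrec\<close> applies to every remaining term.\<close>
    hence "(\<lambda>k. w (Suc k) * x ^ Suc k - w (Suc k) * (p * x) ^ Suc k) sums (F x - F (p * x))"
      using sums_Suc_iff[of "\<lambda>k. w k * x ^ k - w k * (p * x) ^ k"] by simp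
    moreover have "w (Suc k) * x ^ Suc k - w (Suc k) * (p * x) ^ Suc k
        = x * (w k * x ^ k) - a * x * (w k * (p * x) ^ k)" for k
    proof -
      have "w (Suc k) * x ^ Suc k - w (Suc k) * (p * x) ^ Suc k
          = (w (Suc k) * (1 - p ^ Suc k)) * x ^ Suc k"
        by (simp add: algebra_simps power_mult_distrib)
      also have "\<dots> = x * (w k * x ^ k) - a * x * (w k * (p * x) ^ k)"
        unfolding wrec by (simp add: algebra_simps power_mult_distrib)
      finally show ?thesis .
    qed
    ultimately have "(\<lambda>k. x * (w k * x ^ k) - a * x * (w k * (p * x) ^ k)) sums (F x - F (p * x))"
      by simp
    moreover have "(\<lambda>k. x * (w k * x ^ k) - a * x * (w k * (p * x) ^ k)) sums (x * F x - a * x * F (p * x))"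
      by (intro sums_diff sums_mult s)
    ultimately have "F x - F (p * x) = x * F x - a * x * F (p * x)"
      by (rule sums_unique2)
    thus ?thesis by (simp add: algebra_simps)
  qed
  have "isCont F 0"
    unfolding F_def by (rule isCont_powser[of _ "1/2"]) (auto intro: summ)
  from q_functional_equation_solution[OF p z feq this]
  have "q_pochhammer_inf z p * F z = q_pochhammer_inf (a * z) p * F 0" .
  moreover have "F 0 = q_pochhammer_inf p p / q_pochhammer_inf a p"
    unfolding F_def powser_zero by (simp add: w_def)
  ultimately have "F z = q_pochhammer_inf p p * q_pochhammer_inf (a * z) p
      / (q_pochhammer_inf a p * q_pochhammer_inf z p)"
    using q_pochhammer_inf_pos[of p z] q_pochhammer_inf_pos[of p a] p z a by (simp add: field_simps)
  moreover have "(\<lambda>k. w k * z ^ k) sums F z"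
    unfolding F_def using summ[of z] z by (simp add: summable_sums)
  ultimately show ?thesis by (simp add: w_def)
qed

section \<open>The \<open>q\<close>-Gamma function and the \<open>q\<close>-beta integral\<close>

lemma Gamma_q2_pos:
  assumes q: "0 < q" "q < 1" and x: "0 < x"
  shows "0 < Gamma_q2 q x"
proof -
  have "q\<^sup>2 < 1" using q by (simp add: power_less_one_iff)
  moreover have "q powr (2 * x) < 1" using q x by (simp add: powr01_less_one)
  ultimately show ?thesis
    unfolding Gamma_q2_def using q by (intro mult_pos_pos divide_pos_pos q_pochhammer_inf_pos) auto
qed

lemma Gamma_q2_add_1:
  assumes q: "0 < q" "q < 1" and x: "0 < x"
  shows "Gamma_q2 q (x + 1) = Gamma_q2 q x * ((1 - q powr (2 * x)) / (1 - q\<^sup>2))"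
proof -
  have q2: "q\<^sup>2 < 1" using q by (simp add: power_less_one_iff)
  have lt: "q powr (2 * x) < 1" using q x by (simp add: powr01_less_one)
  have e: "q powr (2 * (x + 1)) = q powr (2 * x) * q\<^sup>2"
    using q by (simp add: ring_distribs powr_add powr_numeral)
  have "q_pochhammer_inf (q powr (2 * x)) (q\<^sup>2)
      = (1 - q powr (2 * x)) * q_pochhammer_inf (q powr (2 * (x + 1))) (q\<^sup>2)"
    unfolding e using q2 lt by (intro q_pochhammer_inf_rec) auto
  moreover have "(1 - q\<^sup>2) powr (1 - (x + 1)) = (1 - q\<^sup>2) powr (1 - x) / (1 - q\<^sup>2)"
  proof -
    have "(1 - q\<^sup>2) powr (1 - x - 1) = (1 - q\<^sup>2) powr (1 - x) / (1 - q\<^sup>2)"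
      unfolding powr_diff using q2 by simp
    thus ?thesis by (simp add: algebra_simps)
  qed
  ultimately show ?thesis
    unfolding Gamma_q2_def using lt by simp
qed

lemma Gamma_q2_1:
  assumes q: "0 < q" "q < 1"
  shows "Gamma_q2 q 1 = 1"
proof -
  have "q\<^sup>2 < 1" using q by (simp add: power_less_one_iff)
  thus ?thesis
    using q_pochhammer_inf_pos[of "q\<^sup>2" "q\<^sup>2"] q by (simp add: Gamma_q2_def powr_numeral)
qed

lemma q_fact_Suc: "q_fact q (Suc n) = q_fact q n * ((1 - q powr (real (Suc n))) / (1 - q))"
  by (simp add: q_fact_def q_number_def)

lemma q_fact_ge_1:
  assumes q: "0 < q" "q < 1"
  shows "1 \<le> q_fact q n"
proof (induction n)
  case (Suc n)
  have "q powr (real (Suc n)) \<le> q powr 1"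
    using q by (intro powr_mono') auto
  hence "1 \<le> (1 - q powr (real (Suc n))) / (1 - q)"
    using q by simp
  with Suc have "1 * 1 \<le> q_fact q n * ((1 - q powr (real (Suc n))) / (1 - q))"
    by (intro mult_mono) auto
  thus ?case
    unfolding q_fact_Suc by simp
qed (simp add: q_fact_def)

text \<open>One half-step of the duplication formula. Raising x = (m+1)/2 by one costs (1 - q^(m+1))
  / (1 - q^2), and the new factor 1 + q turns this into the q-number of m+1. The other Gamma value y
  is a bystander; the two Gamma factors take turns in the role of x.\<close>

lemma Gamma_q2_add_1_q_fact:
  assumes q: "0 < q" "q < 1" and x: "0 < x" "2 * x = real (Suc m)"
    and "Gamma_q2 q x * y * (1 + q) ^ m = C * q_fact q m"
  shows "Gamma_q2 q (x + 1) * y * (1 + q) ^ Suc m = C * q_fact q (Suc m)"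
proof -
  have "1 - q\<^sup>2 = (1 - q) * (1 + q)" by (simp add: power2_eq_square algebra_simps)
  hence e: "t / (1 - q\<^sup>2) * (1 + q) = t / (1 - q)" for t
    using q by simp
  have "Gamma_q2 q (x + 1) * y * (1 + q) ^ Suc m
      = (Gamma_q2 q x * y * (1 + q) ^ m) * ((1 - q powr real (Suc m)) / (1 - q\<^sup>2) * (1 + q))"
    unfolding Gamma_q2_add_1[OF q x(1)] x(2) by (simp only: mult_ac power_Suc)
  also have "\<dots> = C * q_fact q (Suc m)"
    unfolding assms(5) e q_fact_Suc by (simp only: mult_ac)
  finally show ?thesis .
qed

text \<open>Each induction step uses the half-step twice, first raising the half-integer argument
  and then the integer one, which adds the q-numbers of 2n+1 and 2n+2.\<close>

lemma Gamma_q2_duplication: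
  assumes q: "0 < q" "q < 1"
  shows "Gamma_q2 q (real n + 1 / 2) * Gamma_q2 q (real n + 1) * (1 + q) ^ (2 * n)
           = Gamma_q2 q (1 / 2) * q_fact q (2 * n)"
proof (induction n)
  case 0
  show ?case using Gamma_q2_1[OF q] by (simp add: q_fact_def)
next
  case (Suc n)
  have "Gamma_q2 q (real n + 3 / 2) * Gamma_q2 q (real n + 1) * (1 + q) ^ (2 * n + 1)
      = Gamma_q2 q (1 / 2) * q_fact q (2 * n + 1)"
    using Gamma_q2_add_1_q_fact[OF q _ _ Suc] by (simp add: add.commute)
  hence "Gamma_q2 q (real n + 1) * Gamma_q2 q (real n + 3 / 2) * (1 + q) ^ (2 * n + 1)
      = Gamma_q2 q (1 / 2) * q_fact q (2 * n + 1)"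
    by (simp only: mult_ac)
  from Gamma_q2_add_1_q_fact[OF q _ _ this]
  have "Gamma_q2 q (real n + 1 + 1) * Gamma_q2 q (real n + 3 / 2) * (1 + q) ^ Suc (2 * n + 1)
      = Gamma_q2 q (1 / 2) * q_fact q (Suc (2 * n + 1))"
    by simp
  moreover have "real (Suc n) + 1 / 2 = real n + 3 / 2" "real (Suc n) + 1 = real n + 1 + 1"
    "2 * Suc n = Suc (2 * n + 1)"
    by simp_all
  ultimately show ?case
    by (simp only: mult_ac)
qed

lemma Gamma_q2_duplication_odd:
  assumes q: "0 < q" "q < 1"
  shows "Gamma_q2 q (real n + 3 / 2) * Gamma_q2 q (real n + 1) * (1 + q) ^ (2 * n + 1)
           = Gamma_q2 q (1 / 2) * q_fact q (2 * n + 1)"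
  using Gamma_q2_add_1_q_fact[OF q _ _ Gamma_q2_duplication[OF q]] by (simp add: add.commute)

lemma W_kernel_power:
  "W_kernel q \<alpha> (q ^ k) = q_pochhammer_inf (q\<^sup>2 * (q\<^sup>2) ^ k) (q\<^sup>2)
     / q_pochhammer_inf (q powr (2 * \<alpha> + 1) * (q\<^sup>2) ^ k) (q\<^sup>2)"
  by (simp add: W_kernel_def mult_ac power_mult [symmetric])

text \<open>A discrete form of the beta integral of t^(2y-1) (1 - t^2)^(\<alpha>-1/2) over [0,1]:
  the q-binomial theorem with z = q^(2y). The exponents of 1 - q^2 in the two Gamma factors add up
  to one more than the exponent in the denominator, which leaves the factor 1 - q^2.\<close>

lemma W_kernel_moment:
  assumes q: "0 < q" "q < 1" and \<alpha>: "\<alpha> > - 1 / 2" and y: "0 < y"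
  shows "(\<lambda>k. W_kernel q \<alpha> (q ^ k) * (q powr (2 * y)) ^ k) sums
    (Gamma_q2 q (\<alpha> + 1 / 2) * Gamma_q2 q y / (Gamma_q2 q (\<alpha> + 1 / 2 + y) * (1 - q\<^sup>2)))"
proof -
  let ?P = "\<lambda>a. q_pochhammer_inf a (q\<^sup>2)"
  have q2: "0 < q\<^sup>2" "q\<^sup>2 < 1" using q by (auto simp: power_less_one_iff)
  have lt: "q powr (2 * \<alpha> + 1) < 1" "q powr (2 * y) < 1"
    using q \<alpha> y by (auto simp: powr01_less_one)
  have e: "q powr (2 * (\<alpha> + 1 / 2)) = q powr (2 * \<alpha> + 1)"
    "q powr (2 * (\<alpha> + 1 / 2 + y)) = q powr (2 * \<alpha> + 1) * q powr (2 * y)"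
    by (simp_all add: ring_distribs powr_add)
  have "(1 - q\<^sup>2) powr (1 - (\<alpha> + 1 / 2)) * (1 - q\<^sup>2) powr (1 - y)
      = (1 - q\<^sup>2) powr (1 - (\<alpha> + 1 / 2 + y)) * (1 - q\<^sup>2) powr 1"
    unfolding powr_add[symmetric] by (rule arg_cong) simp
  hence pw: "(1 - q\<^sup>2) powr (1 - (\<alpha> + 1 / 2)) * (1 - q\<^sup>2) powr (1 - y)
      = (1 - q\<^sup>2) powr (1 - (\<alpha> + 1 / 2 + y)) * (1 - q\<^sup>2)"
    using q2 by simp
  have prod_lt: "q powr (2 * \<alpha> + 1) * q powr (2 * y) < 1"
    unfolding powr_add[symmetric] using q \<alpha> y by (simp add: powr01_less_one)
  have pos: "0 < ?P (q\<^sup>2)" "0 < ?P (q powr (2 * \<alpha> + 1))" "0 < ?P (q powr (2 * y))"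
    "0 < ?P (q powr (2 * \<alpha> + 1) * q powr (2 * y))"
    using q2 lt prod_lt by (auto intro!: q_pochhammer_inf_pos)
  have "Gamma_q2 q (\<alpha> + 1 / 2) * Gamma_q2 q y
      = (?P (q\<^sup>2))\<^sup>2 / (?P (q powr (2 * \<alpha> + 1)) * ?P (q powr (2 * y)))
        * ((1 - q\<^sup>2) powr (1 - (\<alpha> + 1 / 2)) * (1 - q\<^sup>2) powr (1 - y))"
    unfolding Gamma_q2_def e by (simp add: power2_eq_square)
  also have "\<dots> = ?P (q\<^sup>2) * ?P (q powr (2 * \<alpha> + 1) * q powr (2 * y))
      / (?P (q powr (2 * \<alpha> + 1)) * ?P (q powr (2 * y)))
      * (Gamma_q2 q (\<alpha> + 1 / 2 + y) * (1 - q\<^sup>2))"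
    unfolding pw Gamma_q2_def e using pos by (simp add: power2_eq_square)
  finally have "Gamma_q2 q (\<alpha> + 1 / 2) * Gamma_q2 q y / (Gamma_q2 q (\<alpha> + 1 / 2 + y) * (1 - q\<^sup>2))
      = ?P (q\<^sup>2) * ?P (q powr (2 * \<alpha> + 1) * q powr (2 * y))
      / (?P (q powr (2 * \<alpha> + 1)) * ?P (q powr (2 * y)))"
    using Gamma_q2_pos[OF q, of "\<alpha> + 1 / 2 + y"] \<alpha> y q2 by simp
  thus ?thesis
    unfolding W_kernel_power
    using q_binomial_theorem[OF q2, of "q powr (2 * \<alpha> + 1)" "q powr (2 * y)"] lt by simp
qed

lemma W_kernel_power_bounds:
  assumes q: "0 < q" "q < 1" and \<alpha>: "\<alpha> > - 1 / 2"
  shows "0 \<le> W_kernel q \<alpha> (q ^ k)"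
    and "W_kernel q \<alpha> (q ^ k) \<le> 1 / q_pochhammer_inf (q powr (2 * \<alpha> + 1)) (q\<^sup>2)"
  unfolding W_kernel_power
  using q \<alpha> by (auto intro!: q_binomial_weight_bounds simp: power_less_one_iff powr01_less_one)

section \<open>Power series of the kernels\<close>

text \<open>The term is the n-th power of q^(n+1) |x|, and this base tends to 0, so the series is
  eventually below a geometric one for every x.\<close>

lemma summable_q_square_power:
  fixes q x :: real
  assumes q: "0 < q" "q < 1"
  shows "summable (\<lambda>n. q ^ (n * (n + 1)) * \<bar>x\<bar> ^ n)"
proof -
  have "(\<lambda>n. q ^ (n + 1) * \<bar>x\<bar>) \<longlonglongrightarrow> 0 * \<bar>x\<bar>"
    using q LIMSEQ_Suc[OF LIMSEQ_realpow_zero[of q]] by (intro tendsto_mult tendsto_const) simp_all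
  hence "eventually (\<lambda>n. q ^ (n + 1) * \<bar>x\<bar> < 1 / 2) sequentially"
    by (intro order_tendstoD) auto
  moreover have "norm (q ^ (n * (n + 1)) * \<bar>x\<bar> ^ n) \<le> (1 / 2) ^ n" if "q ^ (n + 1) * \<bar>x\<bar> < 1 / 2" for n
  proof -
    have "q ^ (n * (n + 1)) * \<bar>x\<bar> ^ n = (q ^ (n + 1) * \<bar>x\<bar>) ^ n"
      unfolding power_mult_distrib power_mult [symmetric] by (simp only: mult.commute)
    also have "\<dots> \<le> (1 / 2) ^ n"
      using that q by (intro power_mono) auto
    finally show ?thesis using q by simp
  qed
  ultimately show ?thesis
    by (intro summable_comparison_test_ev[OF _ summable_geometric[of "1 / 2 :: real"]])
       (auto elim: eventually_mono)
qed

section \<open>Exchanging a power series with a weighted sum\<close>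

lemma summable_on_product_nonneg:
  fixes u :: "'a \<Rightarrow> real" and v :: "'b \<Rightarrow> real"
  assumes u: "u summable_on A" "\<And>x. x \<in> A \<Longrightarrow> 0 \<le> u x"
    and v: "v summable_on B" "\<And>y. y \<in> B \<Longrightarrow> 0 \<le> v y"
  shows "(\<lambda>(x, y). u x * v y) summable_on A \<times> B"
proof (rule summable_on_SigmaI)
  show "((\<lambda>y. case (x, y) of (x, y) \<Rightarrow> u x * v y) has_sum u x * infsum v B) B" for x
    using has_sum_cmult_right[OF has_sum_infsum[OF v(1)]] by simp
  show "(\<lambda>x. u x * infsum v B) summable_on A"
    by (rule summable_on_cmult_left[OF u(1)])
qed (use u v in auto)

text \<open>Fubini, with the majorant |d n| * M * r^k. In the application d holds the coefficients
  of a power series and \<open>B n\<close> is the n-th moment of the weight w. The second conclusion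
  later yields the convergence of the q-Bessel series, without a separate estimate for their
  coefficients.\<close>

lemma sums_swap_geometric:
  fixes d w z B :: "nat \<Rightarrow> real"
  assumes d: "summable (\<lambda>n. \<bar>d n\<bar>)" and w: "\<And>k. \<bar>w k\<bar> \<le> M"
    and z: "\<And>n. 0 \<le> z n" "\<And>n. z n \<le> r" "r < 1"
    and B: "\<And>n. (\<lambda>k. w k * z n ^ k) sums B n"
  shows "((\<lambda>k. w k * (\<Sum>n. d n * z n ^ k)) has_sum (\<Sum>n. d n * B n)) UNIV"
    and "summable (\<lambda>n. d n * B n)"
proof -
  have r: "0 \<le> r" using z(1,2)[of 0] by linarith
  have M: "0 \<le> M" using w[of 0] by linarith
  let ?f = "\<lambda>n k. d n * (w k * z n ^ k)"
  have bound: "\<bar>w k * z n ^ k\<bar> \<le> M * r ^ k" for n k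
    using w M z r by (auto simp: abs_mult power_abs intro!: mult_mono power_mono)
  have sum_r: "summable (\<lambda>k. M * r ^ k)"
    using r z(3) by (intro summable_mult summable_geometric) auto
  have "(\<lambda>(n, k). \<bar>d n\<bar> * (M * r ^ k)) summable_on UNIV \<times> UNIV"
    using d sum_r r M
    by (intro summable_on_product_nonneg norm_summable_imp_summable_on) (auto simp: abs_mult)
  hence "(\<lambda>x. norm (case x of (n, k) \<Rightarrow> ?f n k)) summable_on UNIV \<times> UNIV"
    by (rule Infinite_Sum.abs_summable_on_comparison_test')
       (use bound in \<open>auto simp: abs_mult [of "d _"] intro!: mult_left_mono\<close>)
  hence summ: "(\<lambda>(n, k). ?f n k) summable_on UNIV \<times> UNIV"
    by (rule abs_summable_summable)
  have hs: "((\<lambda>k. w k * z n ^ k) has_sum B n) UNIV" for n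
    using bound by (intro norm_summable_imp_has_sum B summable_comparison_test'[OF sum_r]) auto
  have inner: "(\<Sum>\<^sub>\<infinity>k. ?f n k) = d n * B n" for n
    by (rule infsumI[OF has_sum_cmult_right[OF hs]])
  have summable_abs: "summable (\<lambda>n. \<bar>d n * z n ^ k\<bar>)" for k
  proof (rule summable_comparison_test'[OF d])
    have "z n ^ k \<le> 1" for n
      using z(1)[of n] z(2)[of n] z(3) by (intro power_le_one) auto
    thus "norm \<bar>d n * z n ^ k\<bar> \<le> \<bar>d n\<bar>" for n
      using z(1)[of n] by (simp add: abs_mult mult_left_le)
  qed
  have inner': "(\<Sum>\<^sub>\<infinity>n. ?f n k) = w k * (\<Sum>n. d n * z n ^ k)" for k
  proof -
    have s: "summable (\<lambda>n. \<bar>d n * z n ^ k\<bar>)"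
      by (rule summable_abs)
    have "((\<lambda>n. d n * z n ^ k) has_sum (\<Sum>n. d n * z n ^ k)) UNIV"
      by (intro norm_summable_imp_has_sum summable_sums summable_rabs_cancel[OF s]) (use s in simp)
    hence "((\<lambda>n. w k * (d n * z n ^ k)) has_sum w k * (\<Sum>n. d n * z n ^ k)) UNIV"
      by (rule has_sum_cmult_right)
    thus ?thesis
      by (intro infsumI) (simp add: mult.left_commute)
  qed
  have "(\<lambda>n. \<Sum>\<^sub>\<infinity>k. ?f n k) summable_on UNIV"
    using summable_on_Sigma_banach[OF summ] by simp
  hence "((\<lambda>n. d n * B n) has_sum (\<Sum>\<^sub>\<infinity>n. \<Sum>\<^sub>\<infinity>k. ?f n k)) UNIV"
    unfolding inner by (rule has_sum_infsum)
  note dB_sums = has_sum_imp_sums[OF this]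
  have total: "(\<Sum>\<^sub>\<infinity>n. \<Sum>\<^sub>\<infinity>k. ?f n k) = (\<Sum>n. d n * B n)"
    by (rule sums_unique[OF dB_sums])
  have "(\<lambda>(k, n). ?f n k) summable_on UNIV \<times> UNIV"
    using summ summable_on_reindex_bij_betw[of prod.swap UNIV UNIV "\<lambda>(n, k). ?f n k"]
    by (simp add: case_prod_unfold)
  from summable_on_Sigma_banach[OF this]
  have "(\<lambda>k. \<Sum>\<^sub>\<infinity>n. ?f n k) summable_on UNIV" by simp
  hence "((\<lambda>k. w k * (\<Sum>n. d n * z n ^ k)) has_sum (\<Sum>\<^sub>\<infinity>k. \<Sum>\<^sub>\<infinity>n. ?f n k)) UNIV"
    unfolding inner' by (rule has_sum_infsum)
  thus "((\<lambda>k. w k * (\<Sum>n. d n * z n ^ k)) has_sum (\<Sum>n. d n * B n)) UNIV"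
    unfolding infsum_swap_banach[OF summ, symmetric] total .
  show "summable (\<lambda>n. d n * B n)"
    using dB_sums by (rule sums_summable)
qed

text \<open>Arguments are real wherever the series are evaluated, so estimates and rearrangements
  are done over the reals. For the sine one factor of the argument is taken out, which makes both
  functions series in y^2.\<close>

definition q_cos_coeff :: "real \<Rightarrow> nat \<Rightarrow> real" where
  "q_cos_coeff q n = (- 1) ^ n * q ^ (n * (n + 1)) / q_fact q (2 * n)"

definition q_sin_coeff :: "real \<Rightarrow> nat \<Rightarrow> real" where
  "q_sin_coeff q n = (- 1) ^ n * q ^ (n * (n + 1)) / q_fact q (2 * n + 1)"

text \<open>Every q-factorial is at least 1, so one majorant without denominators serves both
  series.\<close>

lemma summable_q_trig_coeff:
  assumes q: "0 < q" "q < 1"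
  shows "summable (\<lambda>n. \<bar>q_cos_coeff q n * y ^ (2 * n)\<bar>)"
    and "summable (\<lambda>n. \<bar>q_sin_coeff q n * y ^ (2 * n)\<bar>)"
proof -
  have s: "summable (\<lambda>n. q ^ (n * (n + 1)) * (y\<^sup>2) ^ n)"
    using summable_q_square_power[OF q, of "y\<^sup>2"] by simp
  have bound: "\<bar>(- 1) ^ n * q ^ (n * (n + 1)) / q_fact q m * y ^ (2 * n)\<bar> \<le> q ^ (n * (n + 1)) * (y\<^sup>2) ^ n" for n m
  proof -
    let ?t = "q ^ (n * (n + 1)) * (y\<^sup>2) ^ n"
    have "\<bar>(- 1) ^ n * q ^ (n * (n + 1)) / q_fact q m * y ^ (2 * n)\<bar> = ?t / q_fact q m"
      using q q_fact_ge_1[OF q, of m]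
      by (simp add: abs_mult power_mult power_abs)
    also have "\<dots> \<le> ?t / 1"
      using q q_fact_ge_1[OF q, of m] by (intro divide_left_mono) auto
    finally show ?thesis by simp
  qed
  show "summable (\<lambda>n. \<bar>q_cos_coeff q n * y ^ (2 * n)\<bar>)"
    by (rule summable_comparison_test'[OF s]) (use bound in \<open>simp add: q_cos_coeff_def\<close>)
  show "summable (\<lambda>n. \<bar>q_sin_coeff q n * y ^ (2 * n)\<bar>)"
    by (rule summable_comparison_test'[OF s]) (use bound in \<open>simp add: q_sin_coeff_def\<close>)
qed

lemma q_cos_of_real:
  assumes q: "0 < q" "q < 1"
  shows "q_cos q (of_real y) = of_real (\<Sum>n. q_cos_coeff q n * y ^ (2 * n))"
proof -
  have "(\<lambda>n. of_real (q_cos_coeff q n * y ^ (2 * n)) :: complex) sums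
      of_real (\<Sum>n. q_cos_coeff q n * y ^ (2 * n))"
    by (intro sums_of_real summable_sums summable_rabs_cancel[OF summable_q_trig_coeff(1)[OF q]])
  thus ?thesis
    unfolding q_cos_def by (intro sums_unique[symmetric]) (simp add: q_cos_coeff_def mult_ac)
qed

lemma q_sin_of_real:
  assumes q: "0 < q" "q < 1"
  shows "q_sin q (of_real y) = of_real (y * (\<Sum>n. q_sin_coeff q n * y ^ (2 * n)))"
proof -
  have "(\<lambda>n. of_real (y * (q_sin_coeff q n * y ^ (2 * n))) :: complex) sums
      of_real (y * (\<Sum>n. q_sin_coeff q n * y ^ (2 * n)))"
    by (intro sums_of_real sums_mult summable_sums summable_rabs_cancel[OF summable_q_trig_coeff(2)[OF q]])
  thus ?thesis
    unfolding q_sin_def by (intro sums_unique[symmetric]) (simp add: q_sin_coeff_def mult_ac)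
qed

text \<open>Used with s = 1/2 for the cosine and s = 3/2 for the sine; 2 * (n + s) is the total
  power of q^k that multiplies W(q^k) in the n-th term.\<close>

lemma W_kernel_power_series:
  assumes q: "0 < q" "q < 1" and \<alpha>: "\<alpha> > - 1 / 2" and s: "0 < s"
    and d: "summable (\<lambda>n. \<bar>d n\<bar>)"
  defines "B \<equiv> \<lambda>n. Gamma_q2 q (\<alpha> + 1 / 2) * Gamma_q2 q (real n + s)
       / (Gamma_q2 q (\<alpha> + 1 / 2 + (real n + s)) * (1 - q\<^sup>2))"
  shows "((\<lambda>k. W_kernel q \<alpha> (q ^ k) * (\<Sum>n. d n * (q powr (2 * (real n + s))) ^ k)) has_sum
    (\<Sum>n. d n * B n)) UNIV" and "summable (\<lambda>n. d n * B n)"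
proof -
  have W: "\<bar>W_kernel q \<alpha> (q ^ k)\<bar> \<le> 1 / q_pochhammer_inf (q powr (2 * \<alpha> + 1)) (q\<^sup>2)" for k
    using W_kernel_power_bounds[OF q \<alpha>, of k] by simp
  have z: "q powr (2 * (real n + s)) \<le> q powr (2 * s)" for n
    using q s by (intro powr_mono') auto
  have r: "q powr (2 * s) < 1"
    using q s by (simp add: powr01_less_one)
  have B: "(\<lambda>k. W_kernel q \<alpha> (q ^ k) * (q powr (2 * (real n + s))) ^ k) sums B n" for n
    unfolding B_def using s by (intro W_kernel_moment q \<alpha>) auto
  show "((\<lambda>k. W_kernel q \<alpha> (q ^ k) * (\<Sum>n. d n * (q powr (2 * (real n + s))) ^ k)) has_sum
      (\<Sum>n. d n * B n)) UNIV" and "summable (\<lambda>n. d n * B n)"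
    by (rule sums_swap_geometric[OF d W powr_ge_zero z r B])+
qed

section \<open>Matching the moments of cosine and sine with the q-Bessel functions\<close>

definition bessel_coeff :: "real \<Rightarrow> real \<Rightarrow> nat \<Rightarrow> real" where
  "bessel_coeff q \<alpha> n = (- 1) ^ n * (Gamma_q2 q (\<alpha> + 1) * q ^ (n * (n + 1))
     / (Gamma_q2 q (\<alpha> + real n + 1) * Gamma_q2 q (real n + 1))) / (1 + q) ^ (2 * n)"

lemma q_bessel_j_of_real:
  assumes "summable (\<lambda>n. bessel_coeff q \<alpha> n * y ^ (2 * n))"
  shows "q_bessel_j q \<alpha> (of_real y) = of_real (\<Sum>n. bessel_coeff q \<alpha> n * y ^ (2 * n))"
proof -
  have "(\<lambda>n. of_real (bessel_coeff q \<alpha> n * y ^ (2 * n)) :: complex) sums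
      of_real (\<Sum>n. bessel_coeff q \<alpha> n * y ^ (2 * n))"
    by (intro sums_of_real summable_sums assms)
  thus ?thesis
    unfolding q_bessel_j_def
    by (intro sums_unique[symmetric]) (simp add: bessel_coeff_def power_divide mult_ac)
qed

text \<open>Duplication trades the half-integer Gamma value over the q-factorial for the second
  Gamma factor of the Bessel denominator; the first is already there, since (\<alpha> + 1/2) + (n +
  1/2) = \<alpha> + n + 1. The quotient that remains is independent of n.\<close>

lemma q_cos_coeff_times_Gamma:
  assumes q: "0 < q" "q < 1" and \<alpha>: "\<alpha> > - 1 / 2"
  shows "q_cos_coeff q n * (Gamma_q2 q (\<alpha> + 1 / 2) * Gamma_q2 q (real n + 1 / 2)
      / (Gamma_q2 q (\<alpha> + 1 / 2 + (real n + 1 / 2)) * (1 - q\<^sup>2)))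
    = Gamma_q2 q (\<alpha> + 1 / 2) * Gamma_q2 q (1 / 2) / (Gamma_q2 q (\<alpha> + 1) * (1 - q\<^sup>2))
      * bessel_coeff q \<alpha> n"
proof -
  have pos: "0 < q_fact q (2 * n)" "0 < Gamma_q2 q (real n + 1)" "0 < Gamma_q2 q (\<alpha> + 1)"
    "0 < (1 + q) ^ (2 * n)"
    using q \<alpha> q_fact_ge_1[OF q, of "2 * n"] by (auto intro!: Gamma_q2_pos)
  have G: "Gamma_q2 q (real n + 1 / 2) / q_fact q (2 * n)
      = Gamma_q2 q (1 / 2) / (Gamma_q2 q (real n + 1) * (1 + q) ^ (2 * n))"
  proof (subst frac_eq_eq)
    show "Gamma_q2 q (real n + 1 / 2) * (Gamma_q2 q (real n + 1) * (1 + q) ^ (2 * n))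
        = Gamma_q2 q (1 / 2) * q_fact q (2 * n)"
      using Gamma_q2_duplication[OF q, of n] by (simp only: mult.assoc)
  qed (use pos q in auto)
  have "q_cos_coeff q n * (Gamma_q2 q (\<alpha> + 1 / 2) * Gamma_q2 q (real n + 1 / 2)
      / (Gamma_q2 q (\<alpha> + 1 / 2 + (real n + 1 / 2)) * (1 - q\<^sup>2)))
    = (- 1) ^ n * q ^ (n * (n + 1)) * Gamma_q2 q (\<alpha> + 1 / 2)
      / (Gamma_q2 q (\<alpha> + real n + 1) * (1 - q\<^sup>2))
      * (Gamma_q2 q (real n + 1 / 2) / q_fact q (2 * n))"
    by (simp add: q_cos_coeff_def add_ac mult_ac)
  also have "\<dots> = Gamma_q2 q (\<alpha> + 1 / 2) * Gamma_q2 q (1 / 2) / (Gamma_q2 q (\<alpha> + 1) * (1 - q\<^sup>2))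
      * bessel_coeff q \<alpha> n"
    unfolding G bessel_coeff_def using pos by (simp add: mult_ac)
  finally show ?thesis .
qed

text \<open>As for the cosine, but odd duplication leaves one surplus factor 1 / (1 + q). By
  \<open>G2\<close> it changes the normalisation from \<alpha> to \<alpha> + 1 and creates the
  q-number of 2\<alpha>+2 that stands in the odd part of the Dunkl kernel.\<close>

lemma q_sin_coeff_times_Gamma:
  assumes q: "0 < q" "q < 1" and \<alpha>: "\<alpha> > - 1 / 2"
  shows "q_sin_coeff q n * (Gamma_q2 q (\<alpha> + 1 / 2) * Gamma_q2 q (real n + 3 / 2)
      / (Gamma_q2 q (\<alpha> + 1 / 2 + (real n + 3 / 2)) * (1 - q\<^sup>2)))
    = Gamma_q2 q (\<alpha> + 1 / 2) * Gamma_q2 q (1 / 2) / (Gamma_q2 q (\<alpha> + 1) * (1 - q\<^sup>2))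
      / q_number q (2 * \<alpha> + 2) * bessel_coeff q (\<alpha> + 1) n"
proof -
  have "q powr (2 * \<alpha> + 2) < 1" using q \<alpha> by (simp add: powr01_less_one)
  hence num: "0 < q_number q (2 * \<alpha> + 2)"
    using q by (simp add: q_number_def)
  have pos: "0 < q_fact q (2 * n + 1)" "0 < Gamma_q2 q (real n + 1)" "0 < Gamma_q2 q (\<alpha> + 1)"
    "0 < (1 + q) ^ (2 * n)"
    using q \<alpha> q_fact_ge_1[OF q, of "2 * n + 1"] by (auto intro!: Gamma_q2_pos)
  have "1 - q\<^sup>2 = (1 - q) * (1 + q)" by (simp add: power2_eq_square algebra_simps)
  hence e: "t / (1 - q\<^sup>2) * (1 + q) = t / (1 - q)" for t
    using q by simp
  have "2 * (\<alpha> + 1) = 2 * \<alpha> + 2" by simp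
  hence G2: "Gamma_q2 q (\<alpha> + 1 + 1) * (1 + q) = Gamma_q2 q (\<alpha> + 1) * q_number q (2 * \<alpha> + 2)"
    using Gamma_q2_add_1[OF q, of "\<alpha> + 1"] \<alpha> by (simp only: q_number_def mult.assoc e)
  have G: "Gamma_q2 q (real n + 3 / 2) / q_fact q (2 * n + 1)
      = Gamma_q2 q (1 / 2) / (Gamma_q2 q (real n + 1) * (1 + q) ^ (2 * n + 1))"
  proof (subst frac_eq_eq)
    show "Gamma_q2 q (real n + 3 / 2) * (Gamma_q2 q (real n + 1) * (1 + q) ^ (2 * n + 1))
        = Gamma_q2 q (1 / 2) * q_fact q (2 * n + 1)"
      using Gamma_q2_duplication_odd[OF q, of n] by (simp only: mult.assoc)
  qed (use pos q in auto)
  have "q_sin_coeff q n * (Gamma_q2 q (\<alpha> + 1 / 2) * Gamma_q2 q (real n + 3 / 2)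
      / (Gamma_q2 q (\<alpha> + 1 / 2 + (real n + 3 / 2)) * (1 - q\<^sup>2)))
    = (- 1) ^ n * q ^ (n * (n + 1)) * Gamma_q2 q (\<alpha> + 1 / 2)
      / (Gamma_q2 q (\<alpha> + 1 + real n + 1) * (1 - q\<^sup>2))
      * (Gamma_q2 q (real n + 3 / 2) / q_fact q (2 * n + 1))"
    by (simp add: q_sin_coeff_def add_ac mult_ac)
  also have "\<dots> = Gamma_q2 q (\<alpha> + 1 / 2) * Gamma_q2 q (1 / 2) * (- 1) ^ n * q ^ (n * (n + 1))
      / (Gamma_q2 q (\<alpha> + 1 + real n + 1) * (1 - q\<^sup>2) * Gamma_q2 q (real n + 1) * (1 + q) ^ (2 * n))
      / (1 + q)"
    unfolding G by (simp add: mult_ac)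
  also have "1 / (1 + q) = Gamma_q2 q (\<alpha> + 1 + 1) / (Gamma_q2 q (\<alpha> + 1) * q_number q (2 * \<alpha> + 2))"
    using G2 pos q num by (simp add: field_simps)
  hence "\<And>t. t / (1 + q) = t * (Gamma_q2 q (\<alpha> + 1 + 1) / (Gamma_q2 q (\<alpha> + 1) * q_number q (2 * \<alpha> + 2)))"
    by (metis mult.right_neutral times_divide_eq_right)
  hence "Gamma_q2 q (\<alpha> + 1 / 2) * Gamma_q2 q (1 / 2) * (- 1) ^ n * q ^ (n * (n + 1))
      / (Gamma_q2 q (\<alpha> + 1 + real n + 1) * (1 - q\<^sup>2) * Gamma_q2 q (real n + 1) * (1 + q) ^ (2 * n))
      / (1 + q) = Gamma_q2 q (\<alpha> + 1 / 2) * Gamma_q2 q (1 / 2) / (Gamma_q2 q (\<alpha> + 1) * (1 - q\<^sup>2))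
      / q_number q (2 * \<alpha> + 2) * bessel_coeff q (\<alpha> + 1) n"
    unfolding bessel_coeff_def by (simp add: mult_ac)
  finally show ?thesis .
qed

text \<open>The single extra q^k of the cosine case is the Jackson weight. In the sine case there
  are three: the Jackson weight, the factor t/x, and the leading argument of the sine.\<close>

lemma mult_powr_odd_power:
  fixes q :: real
  assumes "0 < q"
  shows "(q powr (2 * (real n + 1 / 2))) ^ k = q ^ k * (q ^ k) ^ (2 * n)"
    and "(q powr (2 * (real n + 3 / 2))) ^ k = q ^ k * q ^ k * (q ^ k) ^ (2 * n) * q ^ k"
proof -
  have "2 * (real n + 1 / 2) = real (2 * n + 1)" "2 * (real n + 3 / 2) = real (2 * n + 3)"
    by simp_all
  hence "q powr (2 * (real n + 1 / 2)) = q ^ (2 * n + 1)" "q powr (2 * (real n + 3 / 2)) = q ^ (2 * n + 3)"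
    using assms by (simp_all only: powr_realpow)
  thus "(q powr (2 * (real n + 1 / 2))) ^ k = q ^ k * (q ^ k) ^ (2 * n)"
    and "(q powr (2 * (real n + 3 / 2))) ^ k = q ^ k * q ^ k * (q ^ k) ^ (2 * n) * q ^ k"
    by (simp_all only: power_mult [symmetric] power_add [symmetric])
       (simp_all add: algebra_simps eval_nat_numeral)
qed

lemma W_kernel_trig_sums:
  assumes q: "0 < q" "q < 1" and \<alpha>: "\<alpha> > - 1 / 2"
  defines "D \<equiv> Gamma_q2 q (\<alpha> + 1 / 2) * Gamma_q2 q (1 / 2) / (Gamma_q2 q (\<alpha> + 1) * (1 - q\<^sup>2))"
  shows "((\<lambda>k. of_real (q ^ k * W_kernel q \<alpha> (q ^ k)) * q_cos q (of_real (q ^ k * y))) has_sum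
      of_real D * q_bessel_j q \<alpha> (of_real y)) UNIV" (is ?cos)
    and "((\<lambda>k. of_real (q ^ k * W_kernel q \<alpha> (q ^ k) * q ^ k) * q_sin q (of_real (q ^ k * y))) has_sum
      of_real (D / q_number q (2 * \<alpha> + 2) * y) * q_bessel_j q (\<alpha> + 1) (of_real y)) UNIV" (is ?sin)
proof -
  have q2: "q\<^sup>2 < 1" using q by (simp add: power_less_one_iff)
  have D: "D \<noteq> 0"
    unfolding D_def using q q2 \<alpha> Gamma_q2_pos[OF q] by (simp add: less_imp_neq[symmetric])
  have "q powr (2 * \<alpha> + 2) < 1" using q \<alpha> by (simp add: powr01_less_one)
  hence num: "q_number q (2 * \<alpha> + 2) \<noteq> 0"
    unfolding q_number_def using q less_imp_neq by fastforce
  let ?B = "\<lambda>s n. Gamma_q2 q (\<alpha> + 1 / 2) * Gamma_q2 q (real n + s)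
       / (Gamma_q2 q (\<alpha> + 1 / 2 + (real n + s)) * (1 - q\<^sup>2))"
  note summ = summable_q_trig_coeff[OF q]
  \<comment> \<open>Instantiated below with y^(2n) in the middle, to bring the coefficient next to
    its moment.\<close>
  have comm: "a * b * c = a * c * b" for a b c :: real
    by (simp only: mult_ac)
  show ?cos
  proof -
    let ?d = "\<lambda>n. q_cos_coeff q n * y ^ (2 * n)"
    have dB: "?d n * ?B (1 / 2) n = D * (bessel_coeff q \<alpha> n * y ^ (2 * n))" for n
      unfolding comm[of _ "y ^ (2 * n)"] q_cos_coeff_times_Gamma[OF q \<alpha>] D_def by (simp only: mult.assoc)
    have d: "(\<Sum>n. ?d n * (q powr (2 * (real n + 1 / 2))) ^ k)
        = q ^ k * (\<Sum>n. q_cos_coeff q n * (q ^ k * y) ^ (2 * n))" for k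
      unfolding suminf_mult[OF summable_rabs_cancel[OF summ(1)], symmetric] mult_powr_odd_power(1)[OF q(1)]
      by (simp only: power_mult_distrib mult_ac)
    \<comment> \<open>By \<open>dB\<close> the terms are those of the interchanged series divided by
      the nonzero constant \<open>D\<close>, so convergence is inherited from the exchange.\<close>
    have bs: "summable (\<lambda>n. bessel_coeff q \<alpha> n * y ^ (2 * n))"
      using W_kernel_power_series(2)[OF q \<alpha> _ summ(1), of "1 / 2" y] D
      unfolding dB by (simp add: summable_cmult_iff)
    have "((\<lambda>k. q ^ k * W_kernel q \<alpha> (q ^ k) * (\<Sum>n. q_cos_coeff q n * (q ^ k * y) ^ (2 * n))) has_sum
        D * (\<Sum>n. bessel_coeff q \<alpha> n * y ^ (2 * n))) UNIV"
      using W_kernel_power_series(1)[OF q \<alpha> _ summ(1), of "1 / 2" y]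
      unfolding dB d suminf_mult[OF bs] by (simp add: mult_ac)
    hence "((\<lambda>k. of_real (q ^ k * W_kernel q \<alpha> (q ^ k) * (\<Sum>n. q_cos_coeff q n * (q ^ k * y) ^ (2 * n))) :: complex)
        has_sum of_real (D * (\<Sum>n. bessel_coeff q \<alpha> n * y ^ (2 * n)))) UNIV"
      by (rule has_sum_of_real)
    thus ?thesis
      unfolding q_cos_of_real[OF q] q_bessel_j_of_real[OF bs]
      unfolding of_real_mult .
  qed
  show ?sin
  proof -
    let ?d = "\<lambda>n. q_sin_coeff q n * y ^ (2 * n)"
    let ?E = "D / q_number q (2 * \<alpha> + 2)"
    have dB: "?d n * ?B (3 / 2) n = ?E * (bessel_coeff q (\<alpha> + 1) n * y ^ (2 * n))" for n
      unfolding comm[of _ "y ^ (2 * n)"] q_sin_coeff_times_Gamma[OF q \<alpha>] D_def by (simp only: mult.assoc)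
    have d: "(\<Sum>n. ?d n * (q powr (2 * (real n + 3 / 2))) ^ k)
        = q ^ k * q ^ k * q ^ k * (\<Sum>n. q_sin_coeff q n * (q ^ k * y) ^ (2 * n))" for k
      unfolding suminf_mult[OF summable_rabs_cancel[OF summ(2)], symmetric] mult_powr_odd_power(2)[OF q(1)]
      by (simp only: power_mult_distrib mult_ac)
    have bs: "summable (\<lambda>n. bessel_coeff q (\<alpha> + 1) n * y ^ (2 * n))"
      using W_kernel_power_series(2)[OF q \<alpha> _ summ(2), of "3 / 2" y] D num
      unfolding dB by (simp add: summable_cmult_iff)
    have "((\<lambda>k. W_kernel q \<alpha> (q ^ k) * (q ^ k * q ^ k * q ^ k * (\<Sum>n. q_sin_coeff q n * (q ^ k * y) ^ (2 * n)))) has_sum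
        ?E * (\<Sum>n. bessel_coeff q (\<alpha> + 1) n * y ^ (2 * n))) UNIV"
      using W_kernel_power_series(1)[OF q \<alpha> _ summ(2), of "3 / 2" y]
      unfolding dB d suminf_mult[OF bs] by simp
    \<comment> \<open>This restores the factor y that was taken out of the sine series.\<close>
    from has_sum_cmult_right[OF this, of y]
    have "((\<lambda>k. q ^ k * W_kernel q \<alpha> (q ^ k) * q ^ k * (q ^ k * y * (\<Sum>n. q_sin_coeff q n * (q ^ k * y) ^ (2 * n)))) has_sum
        ?E * y * (\<Sum>n. bessel_coeff q (\<alpha> + 1) n * y ^ (2 * n))) UNIV"
      by (simp only: mult_ac)
    hence "((\<lambda>k. of_real (q ^ k * W_kernel q \<alpha> (q ^ k) * q ^ k *
        (q ^ k * y * (\<Sum>n. q_sin_coeff q n * (q ^ k * y) ^ (2 * n)))) :: complex)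
        has_sum of_real (?E * y * (\<Sum>n. bessel_coeff q (\<alpha> + 1) n * y ^ (2 * n)))) UNIV"
      by (rule has_sum_of_real)
    thus ?thesis
      unfolding q_sin_of_real[OF q] q_bessel_j_of_real[OF bs]
      unfolding of_real_mult .
  qed
qed

section \<open>The Sonine-type formula for the q-Dunkl kernel, its constants, and a bound for the
  exponential\<close>

lemma q_exp_imaginary:
  assumes q: "0 < q" "q < 1"
  shows "q_exp q (- \<i> * of_real t * of_real l) = q_cos q (of_real (t * l)) - \<i> * q_sin q (of_real (t * l))"
proof -
  have e: "- \<i> * (- \<i> * of_real t * of_real l) = of_real (- (t * l))"
    by (simp add: mult.assoc[symmetric])
  show ?thesis
    unfolding q_exp_def e q_cos_of_real[OF q] q_sin_of_real[OF q] by simp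
qed

text \<open>The cosine sum plus -i times the sine sum. The kernel is taken at -l; the Bessel series
  contain even powers only, so the sign survives just in the odd part.\<close>

lemma q_dunkl_kernel_has_sum:
  assumes q: "0 < q" "q < 1" and \<alpha>: "\<alpha> > - 1 / 2"
  defines "D \<equiv> Gamma_q2 q (\<alpha> + 1 / 2) * Gamma_q2 q (1 / 2) / (Gamma_q2 q (\<alpha> + 1) * (1 - q\<^sup>2))"
  shows "((\<lambda>k. of_real (q ^ k * W_kernel q \<alpha> (q ^ k)) *
      (q_cos q (of_real (q ^ k * x * l)) - \<i> * of_real (q ^ k) * q_sin q (of_real (q ^ k * x * l)))) has_sum
      of_real D * q_dunkl_kernel q \<alpha> (- of_real l) x) UNIV"
proof -
  have j: "q_bessel_j q \<beta> (- of_real l * of_real x) = q_bessel_j q \<beta> (of_real (x * l))" for \<beta>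
  proof -
    have "- of_real l * of_real x / of_real (1 + q) = - (of_real (x * l) / of_real (1 + q) :: complex)"
      by simp
    moreover have "(- z) ^ (2 * n) = z ^ (2 * n)" for z :: complex and n
      by simp
    ultimately show ?thesis
      unfolding q_bessel_j_def by (simp only:)
  qed
  from has_sum_add[OF W_kernel_trig_sums(1)[OF q \<alpha>, of "x * l"]
      has_sum_cmult_right[OF W_kernel_trig_sums(2)[OF q \<alpha>, of "x * l"], of "- \<i>"]]
  show ?thesis
    unfolding q_dunkl_kernel_def j D_def[symmetric]
    by (simp add: algebra_simps)
qed

text \<open>The bookkeeping of the whole identity: 1 - q is the factor of the inner Jackson
  integral, and 2 comes from adding t and -t. The quotient (1 - q) / (1 - q^2) absorbs the surplus
  power of 1 + q.\<close>

lemma q_dunkl_constants: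
  assumes q: "0 < q" "q < 1" and \<alpha>: "\<alpha> > - 1 / 2"
  shows "K_const q * ((1 + q) powr (- \<alpha> + 1 / 2) / (2 * Gamma_q2 q (\<alpha> + 1 / 2))) * (1 - q) * 2
      * (Gamma_q2 q (\<alpha> + 1 / 2) * Gamma_q2 q (1 / 2) / (Gamma_q2 q (\<alpha> + 1) * (1 - q\<^sup>2)))
    = c_const q \<alpha> / 2"
proof -
  have pos: "0 < Gamma_q2 q (\<alpha> + 1 / 2)" "0 < Gamma_q2 q (1 / 2)" "0 < Gamma_q2 q (\<alpha> + 1)"
    using q \<alpha> by (auto intro!: Gamma_q2_pos)
  have e: "1 - q\<^sup>2 = (1 - q) * (1 + q)" by (simp add: power2_eq_square algebra_simps)
  have "(1 + q) powr (1 / 2) * (1 + q) powr (- \<alpha> + 1 / 2) = (1 + q) powr (- \<alpha> + 1)"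
    unfolding powr_add[symmetric] by (rule arg_cong) simp
  also have "\<dots> = (1 + q) powr (- \<alpha>) * (1 + q)"
    unfolding powr_add using q by simp
  finally have p: "(1 + q) powr (1 / 2) * (1 + q) powr (- \<alpha> + 1 / 2) = (1 + q) powr (- \<alpha>) * (1 + q)" .
  have "K_const q * ((1 + q) powr (- \<alpha> + 1 / 2) / (2 * Gamma_q2 q (\<alpha> + 1 / 2))) * (1 - q) * 2
      * (Gamma_q2 q (\<alpha> + 1 / 2) * Gamma_q2 q (1 / 2) / (Gamma_q2 q (\<alpha> + 1) * (1 - q\<^sup>2)))
      = ((1 + q) powr (1 / 2) * (1 + q) powr (- \<alpha> + 1 / 2)) / (2 * (1 + q) * Gamma_q2 q (\<alpha> + 1))"
    unfolding K_const_def e using pos q by simp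
  also have "\<dots> = c_const q \<alpha> / 2"
  proof -
    have "a * (1 + q) / (2 * (1 + q) * b) = a / b / 2" for a b
      using q nonzero_mult_divide_mult_cancel_left[of "1 + q" a "2 * b"] by (simp add: mult.commute mult.left_commute)
    thus ?thesis unfolding p c_const_def .
  qed
  finally show ?thesis .
qed

text \<open>A bound on bounded sets is enough: the support of f bounds |x|, and |t| is at most |x|
  in the double sum. The majorant is the series of absolute values at the largest argument.\<close>

lemma q_exp_bounded:
  assumes q: "0 < q" "q < 1"
  shows "\<exists>M\<ge>0. \<forall>t. \<bar>t\<bar> \<le> T \<longrightarrow> norm (q_exp q (- \<i> * of_real t * of_real l)) \<le> M"
proof -
  \<comment> \<open>T may be negative, in which case no t qualifies; its absolute value keeps R, and
    with it the final bound, nonnegative.\<close>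
  define R where "R = \<bar>T\<bar> * \<bar>l\<bar>"
  define C where "C = (\<Sum>n. \<bar>q_cos_coeff q n * R ^ (2 * n)\<bar>)"
  define S where "S = (\<Sum>n. \<bar>q_sin_coeff q n * R ^ (2 * n)\<bar>)"
  have R: "0 \<le> R" by (simp add: R_def)
  have series_bound: "\<bar>\<Sum>n. a n * y ^ (2 * n)\<bar> \<le> (\<Sum>n. \<bar>a n * R ^ (2 * n)\<bar>)"
    if a: "summable (\<lambda>n. \<bar>a n * R ^ (2 * n)\<bar>)" and y: "\<bar>y\<bar> \<le> R" for a :: "nat \<Rightarrow> real" and y
  proof -
    have le: "\<bar>a n * y ^ (2 * n)\<bar> \<le> \<bar>a n * R ^ (2 * n)\<bar>" for n
      using power_mono[OF y abs_ge_zero, of "2 * n"] R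
      by (auto simp: abs_mult power_abs intro!: mult_left_mono)
    have s: "summable (\<lambda>n. \<bar>a n * y ^ (2 * n)\<bar>)"
      by (rule summable_comparison_test'[OF a]) (use le in simp)
    show ?thesis
      using summable_rabs[OF s] suminf_le[OF le s a] by linarith
  qed
  have "norm (q_exp q (- \<i> * of_real t * of_real l)) \<le> C + R * S" if t: "\<bar>t\<bar> \<le> T" for t
  proof -
    have y: "\<bar>t * l\<bar> \<le> R"
      using t unfolding R_def abs_mult by (intro mult_right_mono) auto
    have c: "norm (q_cos q (of_real (t * l))) \<le> C"
      unfolding q_cos_of_real[OF q] norm_of_real C_def
      by (rule series_bound[OF summable_q_trig_coeff(1)[OF q] y])
    have "\<bar>\<Sum>n. q_sin_coeff q n * (t * l) ^ (2 * n)\<bar> \<le> S"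
      unfolding S_def by (rule series_bound[OF summable_q_trig_coeff(2)[OF q] y])
    hence "norm (q_sin q (of_real (t * l))) \<le> R * S"
      unfolding q_sin_of_real[OF q] norm_of_real abs_mult[of "t * l"] using y R by (intro mult_mono) auto
    with c show ?thesis
      unfolding q_exp_imaginary[OF q]
      using norm_triangle_ineq4[of "q_cos q (of_real (t * l))" "\<i> * q_sin q (of_real (t * l))"]
      by (simp add: norm_mult)
  qed
  moreover have "0 \<le> C + R * S"
    unfolding C_def S_def using R summable_q_trig_coeff[OF q]
    by (intro add_nonneg_nonneg mult_nonneg_nonneg suminf_nonneg) auto
  ultimately show ?thesis by blast
qed

section \<open>Interchanging the summations\<close>

text \<open>The change of variables from t to x: with |t| = q^m and |x| = q^(m-k), the shear (m, k)
  to (m - k, k) replaces the outer sum over t by one over x. Both iterated sums are compared with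
  the double sum.\<close>

lemma infsum_int_nat_shift:
  fixes B :: "int \<Rightarrow> nat \<Rightarrow> 'a :: banach"
  assumes B: "(\<lambda>(n, k). B n k) summable_on UNIV \<times> UNIV"
  shows "(\<Sum>\<^sub>\<infinity>m. \<Sum>\<^sub>\<infinity>k. B (m - int k) k) = (\<Sum>\<^sub>\<infinity>n. \<Sum>\<^sub>\<infinity>k. B n k)"
    and "(\<lambda>(m, k). B (m - int k) k) summable_on UNIV \<times> UNIV"
proof -
  have bij: "bij_betw (\<lambda>(m, k). (m - int k, k)) (UNIV \<times> UNIV) (UNIV \<times> UNIV)"
    by (rule bij_betwI[where g = "\<lambda>(n, k). (n + int k, k)"]) auto
  have eq: "(\<lambda>x. (\<lambda>(n, k). B n k) ((\<lambda>(m, k). (m - int k, k)) x)) = (\<lambda>(m, k). B (m - int k) k)"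
    by auto
  show s: "(\<lambda>(m, k). B (m - int k) k) summable_on UNIV \<times> UNIV"
    using summable_on_reindex_bij_betw[OF bij, of "\<lambda>(n, k). B n k"] B unfolding eq by simp
  show "(\<Sum>\<^sub>\<infinity>m. \<Sum>\<^sub>\<infinity>k. B (m - int k) k) = (\<Sum>\<^sub>\<infinity>n. \<Sum>\<^sub>\<infinity>k. B n k)"
    unfolding infsum_Sigma'_banach[OF s] infsum_Sigma'_banach[OF B]
    using infsum_reindex_bij_betw[OF bij, of "\<lambda>(n, k). B n k"] unfolding eq .
qed

lemma summable_on_powi_bounded_below:
  fixes x :: real
  assumes "0 < x" "x < 1"
  shows "(\<lambda>n::int. if N \<le> n then x powi n else 0) summable_on UNIV"
proof -
  have bij: "bij_betw (\<lambda>j. N + int j) UNIV {N..}"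
    by (rule bij_betwI[where g = "\<lambda>n. nat (n - N)"]) auto
  have "(\<lambda>j. x powi N * x ^ j) summable_on UNIV"
    using assms by (intro summable_on_cmult_right norm_summable_imp_summable_on) (simp add: summable_geometric)
  hence "(\<lambda>j. x powi (N + int j)) summable_on UNIV"
    using assms by (simp add: power_int_add)
  hence "(\<lambda>n. x powi n) summable_on {N..}"
    using summable_on_reindex_bij_betw[OF bij] by blast
  thus ?thesis
    by (rule summable_on_cong_neutral[THEN iffD1, rotated -1]) auto
qed

text \<open>The bound is order 0 of \<open>Eq_space\<close> on the interval outside of which f
  vanishes on \<open>Rq\<close>. Large |x| corresponds to very negative exponents, hence the
  threshold from below.\<close>

lemma Dq_space_bounded_support:
  assumes q: "0 < q" "q < 1" and f: "f \<in> Dq_space q"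
  obtains M N where "0 \<le> M" "\<And>x. x \<in> Rq q \<Longrightarrow> norm (f x) \<le> M"
    "\<And>n. n < N \<Longrightarrow> f (q powi n) = 0" "\<And>n. n < N \<Longrightarrow> f (- (q powi n)) = 0"
proof -
  from f obtain b where E: "f \<in> Eq_space q" and b: "\<And>x. x \<in> Rq q \<Longrightarrow> \<bar>x\<bar> > b \<Longrightarrow> f x = 0"
    unfolding Dq_space_def by auto
  have "\<forall>a\<ge>0. bdd_above {cmod ((q_deriv q ^^ k) f x) | k x. k \<le> 0 \<and> x \<in> {-a..a} \<inter> Rq q}"
    using E unfolding Eq_space_def mem_Collect_eq by - (drule spec[where x = 0], erule conjunct1)
  hence "bdd_above {cmod ((q_deriv q ^^ k) f x) | k x. k \<le> 0 \<and> x \<in> {-\<bar>b\<bar>..\<bar>b\<bar>} \<inter> Rq q}"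
    by (simp only: abs_ge_zero)
  then obtain M where M: "\<And>y k x. y = cmod ((q_deriv q ^^ k) f x) \<Longrightarrow> k \<le> 0 \<Longrightarrow>
      x \<in> {-\<bar>b\<bar>..\<bar>b\<bar>} \<inter> Rq q \<Longrightarrow> y \<le> M"
    unfolding bdd_above_def by blast
  \<comment> \<open>For b = 0 the bounded set is empty and M could be negative; the maximum also
    covers the points where f vanishes.\<close>
  have bound: "norm (f x) \<le> max M 0" if "x \<in> Rq q" for x
  proof (cases "\<bar>x\<bar> \<le> \<bar>b\<bar>")
    case True
    hence "x \<in> {-\<bar>b\<bar>..\<bar>b\<bar>} \<inter> Rq q" using that by auto
    hence "norm (f x) \<le> M" by (intro M[of _ 0 x]) simp_all
    thus ?thesis by simp
  next
    case False
    hence "f x = 0" using that by (intro b) auto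
    thus ?thesis by simp
  qed
  obtain k where k: "b < inverse q ^ k"
    using real_arch_pow[of "inverse q" b] q by (auto simp: one_less_inverse)
  have big: "b < q powi n" if "n < - int k" for n
  proof -
    have "inverse q ^ k = q powi (- int k)"
      by (simp add: power_int_minus power_inverse)
    also have "\<dots> \<le> q powi n"
      using that q by (intro power_int_decreasing) auto
    finally show ?thesis using k by simp
  qed
  have "q powi n \<in> Rq q" "- (q powi n) \<in> Rq q" for n
    unfolding Rq_def by blast+
  hence "f (q powi n) = 0" "f (- (q powi n)) = 0" if "n < - int k" for n
    using big[OF that] b q by auto
  with bound show ?thesis
    by (intro that[of "max M 0" "- int k"]) auto
qed

text \<open>The term of the inner Jackson sum at t = s * x * q^k, with the contributions of x and -x
  folded together. As W is even, the sign s enters only through 1 + t/x. The leading x is the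
  Jackson weight.\<close>

definition intertwining_summand ::
  "real \<Rightarrow> real \<Rightarrow> (real \<Rightarrow> complex) \<Rightarrow> real \<Rightarrow> real \<Rightarrow> nat \<Rightarrow> complex" where
  "intertwining_summand q \<alpha> f s x k =
     of_real (x * W_kernel q \<alpha> (q ^ k) * x powr (2 * \<alpha>))
       * (of_real (1 + s * q ^ k) * f x + of_real (1 - s * q ^ k) * f (- x))"

lemma W_kernel_sign:
  assumes "\<bar>s\<bar> = 1"
  shows "W_kernel q \<alpha> (s * t) = W_kernel q \<alpha> t"
proof -
  have "s\<^sup>2 = 1" using assms by (metis power2_abs one_power2)
  thus ?thesis by (simp add: W_kernel_def power_mult_distrib)
qed

lemma dual_intertwining_signed_power:
  assumes q: "0 < q" and s: "\<bar>s\<bar> = 1"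
  shows "dual_intertwining q \<alpha> f (s * q powi m) =
    of_real ((1 + q) powr (- \<alpha> + 1 / 2) / (2 * Gamma_q2 q (\<alpha> + 1 / 2))) * of_real (1 - q) *
      (\<Sum>\<^sub>\<infinity>k. intertwining_summand q \<alpha> f s (q powi (m - int k)) k)"
proof -
  define c where "c = (1 + q) powr (- \<alpha> + 1 / 2) / (2 * Gamma_q2 q (\<alpha> + 1 / 2))"
  define g where "g = (\<lambda>x. of_real (W_kernel q \<alpha> (s * q powi m / x) * (1 + s * q powi m / x)) * f x
      * of_real (\<bar>x\<bar> powr (2 * \<alpha>)))"
  let ?a = "q * q powi m"
  have abs: "\<bar>s * q powi m\<bar> = q powi m"
    using q s by (simp add: abs_mult)
  \<comment> \<open>The integral starts at q * |t| with exponents at most -1, so exponent -1 - k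
    gives |x| = q^(m-k): k = 0 is the point |x| = |t|, which is included.\<close>
  have bij: "bij_betw (\<lambda>k. - 1 - int k) UNIV {..-1}"
    by (rule bij_betwI[where g = "\<lambda>j. nat (- 1 - j)"]) auto
  have summand: "of_real ?a * (of_real (q powi (- 1 - int k)) *
      (g (?a * q powi (- 1 - int k)) + g (- (?a * q powi (- 1 - int k)))))
      = intertwining_summand q \<alpha> f s (q powi (m - int k)) k" for k
  proof -
    define x where "x = q powi (m - int k)"
    have x: "0 < x" using q by (simp add: x_def)
    have ax: "?a * q powi (- 1 - int k) = x"
      using q power_int_add[of q "1 + m" "- 1 - int k"] power_int_add[of q 1 m]
      by (simp add: x_def add_ac)
    have m: "q powi m = x * q ^ k"
      using q power_int_add[of q "m - int k" "int k"] by (simp add: x_def)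
    have t: "s * q powi m / x = s * q ^ k" "s * q powi m / - x = (- s) * q ^ k"
      using x by (simp_all add: m)
    have "g x + g (- x) = of_real (W_kernel q \<alpha> (q ^ k) * x powr (2 * \<alpha>))
       * (of_real (1 + s * q ^ k) * f x + of_real (1 - s * q ^ k) * f (- x))"
    proof -
      have W: "W_kernel q \<alpha> (s * q ^ k) = W_kernel q \<alpha> (q ^ k)" "W_kernel q \<alpha> ((- s) * q ^ k) = W_kernel q \<alpha> (q ^ k)"
        using s by (intro W_kernel_sign; simp)+
      show ?thesis
        unfolding g_def t W using x by (simp add: algebra_simps)
    qed
    thus ?thesis
      unfolding mult.assoc[symmetric] of_real_mult[symmetric] ax
      by (simp add: intertwining_summand_def x_def[symmetric] mult.assoc)
  qed
  have "jackson_integral_from q ?a (\<lambda>x. g x + g (- x)) = of_real (1 - q) * (of_real ?a *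
      (\<Sum>\<^sub>\<infinity>k. of_real (q powi (- 1 - int k)) *
        (g (?a * q powi (- 1 - int k)) + g (- (?a * q powi (- 1 - int k))))))"
    unfolding jackson_integral_from_def infsum_reindex_bij_betw[OF bij, symmetric] by (simp add: mult.assoc)
  also have "\<dots> = of_real (1 - q) * (\<Sum>\<^sub>\<infinity>k. intertwining_summand q \<alpha> f s (q powi (m - int k)) k)"
    unfolding infsum_cmult_right'[symmetric] summand ..
  finally show ?thesis
    unfolding dual_intertwining_def Let_def abs g_def[symmetric] c_def[symmetric]
    by (simp add: mult.assoc)
qed

text \<open>One factor x is the inner Jackson weight, one is part of the outer weight |t| = x * q^k,
  and x^(2\<alpha>) is the density. The combined ratio q^(2\<alpha>+2) lies below 1 and makes the
  sum over n converge.\<close>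

lemma powi_square_powr:
  fixes q :: real
  assumes "0 < q"
  shows "q powi n * q powi n * (q powi n) powr (2 * \<alpha>) = (q powr (2 * \<alpha> + 2)) powi n"
proof -
  have p: "x powi n = x powr of_int n" if "0 < x" for x :: real
    using that powr_real_of_int'[of x n] by simp
  show ?thesis
    using assms by (simp add: p powr_powr powr_add [symmetric] algebra_simps)
qed

lemma intertwining_summand_summable:
  assumes q: "0 < q" "q < 1" and \<alpha>: "\<alpha> > - 1 / 2" and f: "f \<in> Dq_space q" and s: "\<bar>s\<bar> = 1"
  shows "(\<lambda>(n, k). of_real (q powi n * q ^ k) * (intertwining_summand q \<alpha> f s (q powi n) k *
      q_exp q (- \<i> * of_real (s * (q powi n * q ^ k)) * of_real l))) summable_on UNIV \<times> UNIV"
proof -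
  obtain M N where M: "0 \<le> M" "\<And>x. x \<in> Rq q \<Longrightarrow> norm (f x) \<le> M"
    and N: "\<And>n. n < N \<Longrightarrow> f (q powi n) = 0" "\<And>n. n < N \<Longrightarrow> f (- (q powi n)) = 0"
    using Dq_space_bounded_support[OF q f] by blast
  obtain L where L: "0 \<le> L" "\<And>t. \<bar>t\<bar> \<le> q powi N \<Longrightarrow> norm (q_exp q (- \<i> * of_real t * of_real l)) \<le> L"
    using q_exp_bounded[OF q, of "q powi N" l] by blast
  define P where "P = 1 / q_pochhammer_inf (q powr (2 * \<alpha> + 1)) (q\<^sup>2)"
  have W: "\<bar>W_kernel q \<alpha> (q ^ k)\<bar> \<le> P" for k
    using W_kernel_power_bounds[OF q \<alpha>, of k] by (simp add: P_def)
  have P: "0 \<le> P" using W[of 0] by linarith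
  define r where "r = q powr (2 * \<alpha> + 2)"
  have r: "0 < r" "r < 1" using q \<alpha> by (auto simp: r_def powr01_less_one)
  \<comment> \<open>\<open>P\<close> bounds W, \<open>L\<close> bounds the exponential for |t| at
    most q^N, and 4 * M bounds the two values of f, each with a coefficient of absolute value at
    most 2.\<close>
  define u where "u n = (P * (4 * M) * L) * (if N \<le> n then r powi n else 0)" for n
  have u: "u summable_on UNIV"
    unfolding u_def by (intro summable_on_cmult_right summable_on_powi_bounded_below r)
  have "(\<lambda>(n, k). u n * q ^ k) summable_on UNIV \<times> UNIV"
    using q r P M L by (intro summable_on_product_nonneg u norm_summable_imp_summable_on)
      (auto simp: u_def summable_geometric)
  hence "(\<lambda>y. norm (case y of (n, k) \<Rightarrow>
      of_real (q powi n * q ^ k) * (intertwining_summand q \<alpha> f s (q powi n) k *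
      q_exp q (- \<i> * of_real (s * (q powi n * q ^ k)) * of_real l)))) summable_on UNIV \<times> UNIV"
  proof (rule Infinite_Sum.abs_summable_on_comparison_test')
    fix y :: "int \<times> nat" assume "y \<in> UNIV \<times> UNIV"
    obtain n k where y: "y = (n, k)" by fastforce
    define x where "x = q powi n"
    have x: "0 < x" using q by (simp add: x_def)
    have qk: "0 < q ^ k" "q ^ k \<le> 1" using q by (auto simp: power_le_one)
    have "norm (of_real (x * q ^ k) * (intertwining_summand q \<alpha> f s x k *
      q_exp q (- \<i> * of_real (s * (x * q ^ k)) * of_real l))) \<le> u n * q ^ k"
    proof (cases "N \<le> n")
      case False
      thus ?thesis by (simp add: intertwining_summand_def N u_def x_def)
    next
      case True
      have xR: "x \<in> Rq q" "- x \<in> Rq q" unfolding Rq_def x_def by blast+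
      have "\<bar>s * q ^ k\<bar> \<le> 1" using s qk by (simp add: abs_mult)
      hence "\<bar>1 + s * q ^ k\<bar> \<le> 2" "\<bar>1 - s * q ^ k\<bar> \<le> 2" by linarith+
      hence "norm (of_real (1 + s * q ^ k) * f x + of_real (1 - s * q ^ k) * f (- x)) \<le> 2 * M + 2 * M"
        using M xR by (intro norm_triangle_mono) (auto simp only: norm_mult norm_of_real norm_ge_zero intro!: mult_mono)
      moreover have "\<bar>x * W_kernel q \<alpha> (q ^ k) * x powr (2 * \<alpha>)\<bar> \<le> x * P * x powr (2 * \<alpha>)"
        using W[of k] x P by (simp add: abs_mult mult_right_mono)
      ultimately have h: "norm (intertwining_summand q \<alpha> f s x k) \<le> x * P * x powr (2 * \<alpha>) * (4 * M)"
        unfolding intertwining_summand_def norm_mult norm_of_real using x P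
        by (intro mult_mono) auto
      have "x \<le> q powi N"
        using True q unfolding x_def by (intro power_int_decreasing) auto
      hence "\<bar>s * (x * q ^ k)\<bar> \<le> q powi N"
        using s x qk order_trans[OF mult_left_le[of "q ^ k" x]] by (simp add: abs_mult)
      hence e: "norm (q_exp q (- \<i> * of_real (s * (x * q ^ k)) * of_real l)) \<le> L"
        by (rule L)
      have norm_x: "norm (of_real (x * q ^ k) :: complex) = x * q ^ k"
        unfolding norm_of_real using x qk by simp
      have "norm (of_real (x * q ^ k) * (intertwining_summand q \<alpha> f s x k *
        q_exp q (- \<i> * of_real (s * (x * q ^ k)) * of_real l)))
        \<le> (x * q ^ k) * (x * P * x powr (2 * \<alpha>) * (4 * M) * L)"
        unfolding norm_mult[of "of_real _"] norm_mult[of "intertwining_summand _ _ _ _ _ _"] norm_x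
        using h e x qk P M L by (intro mult_mono) auto
      also have "\<dots> = (P * (4 * M) * L) * (x * x * x powr (2 * \<alpha>)) * q ^ k"
        by (simp only: mult_ac)
      also have "\<dots> = u n * q ^ k"
        using True powi_square_powr[OF q(1), of n \<alpha>] by (simp only: u_def x_def r_def if_True)
      finally show ?thesis .
    qed
    thus "norm (case y of (n, k) \<Rightarrow>
      of_real (q powi n * q ^ k) * (intertwining_summand q \<alpha> f s (q powi n) k *
      q_exp q (- \<i> * of_real (s * (q powi n * q ^ k)) * of_real l))) \<le> (case y of (n, k) \<Rightarrow> u n * q ^ k)"
      by (simp only: y x_def prod.case)
  qed
  thus ?thesis by (rule abs_summable_summable)
qed

text \<open>With u = q^k, the identity (1 + u)(c - i s) + (1 - u)(c + i s) = 2 (c - i u s) collects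
  the coefficient of f(x). For f(-x) the signs of u are exchanged, which is the kernel at
  -x.\<close>

lemma intertwining_summand_has_sum:
  assumes q: "0 < q" "q < 1" and \<alpha>: "\<alpha> > - 1 / 2" and x: "0 < x"
  defines "D \<equiv> Gamma_q2 q (\<alpha> + 1 / 2) * Gamma_q2 q (1 / 2) / (Gamma_q2 q (\<alpha> + 1) * (1 - q\<^sup>2))"
  shows "((\<lambda>k. of_real (x * q ^ k) * (intertwining_summand q \<alpha> f 1 x k *
        q_exp q (- \<i> * of_real (1 * (x * q ^ k)) * of_real l))
      + of_real (x * q ^ k) * (intertwining_summand q \<alpha> f (- 1) x k *
        q_exp q (- \<i> * of_real ((- 1) * (x * q ^ k)) * of_real l)))
    has_sum (of_real (2 * D) * (of_real x * (f x * q_dunkl_kernel q \<alpha> (- of_real l) x * of_real (\<bar>x\<bar> powr (2 * \<alpha> + 1))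
      + f (- x) * q_dunkl_kernel q \<alpha> (- of_real l) (- x) * of_real (\<bar>- x\<bar> powr (2 * \<alpha> + 1)))))) UNIV"
proof -
  let ?\<psi> = "q_dunkl_kernel q \<alpha> (- of_real l)"
  have powr: "x powr (2 * \<alpha> + 1) = x * x powr (2 * \<alpha>)"
    using x by (simp add: powr_add)
  let ?c = "\<lambda>k. q_cos q (of_real (q ^ k * x * l))" and ?s = "\<lambda>k. q_sin q (of_real (q ^ k * x * l))"
  have neg: "q_cos q (of_real (q ^ k * - x * l)) = ?c k" "q_sin q (of_real (q ^ k * - x * l)) = - ?s k" for k
    unfolding q_cos_of_real[OF q] q_sin_of_real[OF q] by simp_all
  have E: "q_exp q (- \<i> * of_real (1 * (x * q ^ k)) * of_real l) = ?c k - \<i> * ?s k"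
    "q_exp q (- \<i> * of_real ((- 1) * (x * q ^ k)) * of_real l) = ?c k + \<i> * ?s k" for k
  proof -
    have a: "1 * (x * q ^ k) * l = q ^ k * x * l" "(- 1) * (x * q ^ k) * l = q ^ k * - x * l" by simp_all
    show "q_exp q (- \<i> * of_real (1 * (x * q ^ k)) * of_real l) = ?c k - \<i> * ?s k"
      unfolding q_exp_imaginary[OF q] a ..
    show "q_exp q (- \<i> * of_real ((- 1) * (x * q ^ k)) * of_real l) = ?c k + \<i> * ?s k"
      unfolding q_exp_imaginary[OF q] a neg by simp
  qed
  let ?w = "\<lambda>k. of_real (q ^ k * W_kernel q \<alpha> (q ^ k)) :: complex"
  let ?A = "of_real (2 * x * x * x powr (2 * \<alpha>)) :: complex"
  have "((\<lambda>k. ?w k * (?c k - \<i> * of_real (q ^ k) * ?s k)) has_sum of_real D * ?\<psi> x) UNIV"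
    unfolding D_def by (rule q_dunkl_kernel_has_sum[OF q \<alpha>])
  note pos = has_sum_cmult_right[OF this, of "?A * f x"]
  have "((\<lambda>k. ?w k * (?c k - \<i> * of_real (q ^ k) * - ?s k)) has_sum of_real D * ?\<psi> (- x)) UNIV"
    using q_dunkl_kernel_has_sum[OF q \<alpha>, of "- x" l] unfolding D_def neg .
  note neg = has_sum_cmult_right[OF this, of "?A * f (- x)"]
  have lhs: "?A * f x * (?w k * (?c k - \<i> * of_real (q ^ k) * ?s k))
      + ?A * f (- x) * (?w k * (?c k - \<i> * of_real (q ^ k) * - ?s k))
    = of_real (x * q ^ k) * (intertwining_summand q \<alpha> f 1 x k * (?c k - \<i> * ?s k))
      + of_real (x * q ^ k) * (intertwining_summand q \<alpha> f (- 1) x k * (?c k + \<i> * ?s k))" for k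
    unfolding intertwining_summand_def of_real_mult of_real_add of_real_diff of_real_1 of_real_minus of_real_numeral
    by algebra
  \<comment> \<open>Of the powers in \<open>?A\<close>, one x becomes the Jackson weight of the
    Dunkl transform and the rest its density x^(2\<alpha>+1).\<close>
  have rhs: "?A * f x * (of_real D * ?\<psi> x) + ?A * f (- x) * (of_real D * ?\<psi> (- x))
    = of_real (2 * D) * (of_real x * (f x * ?\<psi> x * of_real (\<bar>x\<bar> powr (2 * \<alpha> + 1))
      + f (- x) * ?\<psi> (- x) * of_real (\<bar>- x\<bar> powr (2 * \<alpha> + 1))))"
    using x by (simp add: powr) (simp add: algebra_simps)
  show ?thesis
    using has_sum_add[OF pos neg] unfolding lhs rhs E .
qed

theorem theorem12:
  fixes q \<alpha> l :: real and f :: "real \<Rightarrow> complex"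
  assumes "0 < q" and "q < 1"
    and "\<exists>m::int. ln (1 - q) / ln q = 2 * of_int m"
    and "\<alpha> > - 1 / 2"
    and "f \<in> Dq_space q"
    and "l \<in> Rq q"
  shows "q_dunkl_transform q \<alpha> f l = q2_fourier q (dual_intertwining q \<alpha> f) l"
proof -
  note q = assms(1,2) and \<alpha> = assms(4) and f = assms(5)
  define c where "c = (1 + q) powr (- \<alpha> + 1 / 2) / (2 * Gamma_q2 q (\<alpha> + 1 / 2))"
  define D where "D = Gamma_q2 q (\<alpha> + 1 / 2) * Gamma_q2 q (1 / 2) / (Gamma_q2 q (\<alpha> + 1) * (1 - q\<^sup>2))"
  define E where "E t = q_exp q (- \<i> * of_real t * of_real l)" for t
  define B where "B s n k = of_real (q powi n * q ^ k) *
    (intertwining_summand q \<alpha> f s (q powi n) k * E (s * (q powi n * q ^ k)))" for s n k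
  define T where "T n = of_real (q powi n) *
    (f (q powi n) * q_dunkl_kernel q \<alpha> (- of_real l) (q powi n) * of_real (\<bar>q powi n\<bar> powr (2 * \<alpha> + 1))
     + f (- (q powi n)) * q_dunkl_kernel q \<alpha> (- of_real l) (- (q powi n))
       * of_real (\<bar>- (q powi n)\<bar> powr (2 * \<alpha> + 1)))" for n
  have const: "K_const q * c * (1 - q) * 2 * D = c_const q \<alpha> / 2"
    unfolding c_def D_def by (rule q_dunkl_constants[OF q \<alpha>])
  have summable: "(\<lambda>(n, k). B s n k) summable_on UNIV \<times> UNIV" if "\<bar>s\<bar> = 1" for s
    unfolding B_def E_def by (rule intertwining_summand_summable[OF q \<alpha> f that])
  \<comment> \<open>Since q^m = q^(m-k) * q^k, the outer weight and the exponential depend on (m, k)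
    only through n = m - k and k, so each term is \<open>B s\<close> at the sheared index.\<close>
  have signed: "of_real (q powi m) * (dual_intertwining q \<alpha> f (s * q powi m) * E (s * q powi m))
      = of_real (c * (1 - q)) * (\<Sum>\<^sub>\<infinity>k. B s (m - int k) k)" if "\<bar>s\<bar> = 1" for s m
  proof -
    have "q powi (m - int k) * q ^ k = q powi m" for k
      using q power_int_add[of q "m - int k" "int k"] by simp
    hence "B s (m - int k) k = of_real (q powi m) * E (s * q powi m) *
        intertwining_summand q \<alpha> f s (q powi (m - int k)) k" for k
      unfolding B_def by (simp only: mult_ac)
    hence "(\<Sum>\<^sub>\<infinity>k. B s (m - int k) k) = of_real (q powi m) * E (s * q powi m) *
        (\<Sum>\<^sub>\<infinity>k. intertwining_summand q \<alpha> f s (q powi (m - int k)) k)"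
      by (simp only: infsum_cmult_right')
    thus ?thesis
      unfolding dual_intertwining_signed_power[OF q(1) that] c_def[symmetric] by (simp only: of_real_mult mult_ac)
  qed
  \<comment> \<open>Summability for each fixed m is what allows the sums for t and -t to be merged
    termwise below.\<close>
  have inner: "(\<lambda>k. B s (m - int k) k) summable_on UNIV" if "\<bar>s\<bar> = 1" for s m
    using summable_on_SigmaD1[OF infsum_int_nat_shift(2)[OF summable[OF that]]] by simp
  have both_summable: "(\<lambda>(n, k). B 1 n k + B (- 1) n k) summable_on UNIV \<times> UNIV"
    using summable_on_add[OF summable[of 1] summable[of "- 1"]] by (simp add: case_prod_unfold)
  \<comment> \<open>After the shear x is fixed in each row, so the sum over k is the kernel formula
    at x and at -x.\<close>
  have row_sum: "(\<Sum>\<^sub>\<infinity>k. B 1 n k + B (- 1) n k) = of_real (2 * D) * T n" for n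
    unfolding B_def E_def T_def D_def
    using q by (intro infsumI intertwining_summand_has_sum \<alpha>) auto
  have "q2_fourier q (dual_intertwining q \<alpha> f) l = of_real (K_const q) * (of_real (1 - q) *
      (\<Sum>\<^sub>\<infinity>m. of_real (c * (1 - q)) * ((\<Sum>\<^sub>\<infinity>k. B 1 (m - int k) k) + (\<Sum>\<^sub>\<infinity>k. B (- 1) (m - int k) k))))"
    using signed[of 1] signed[of "- 1"]
    unfolding q2_fourier_def jackson_integral_def E_def[symmetric] by (simp add: distrib_left)
  also have "\<dots> = of_real (K_const q * c * (1 - q) * (1 - q)) *
      (\<Sum>\<^sub>\<infinity>m. \<Sum>\<^sub>\<infinity>k. B 1 (m - int k) k + B (- 1) (m - int k) k)"
    using infsum_add[OF inner[of 1] inner[of "- 1"]] by (simp add: infsum_cmult_right' mult_ac)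
  also have "\<dots> = of_real (K_const q * c * (1 - q) * (1 - q)) * (\<Sum>\<^sub>\<infinity>n. of_real (2 * D) * T n)"
    unfolding infsum_int_nat_shift(1)[OF both_summable] row_sum ..
  also have "\<dots> = of_real (K_const q * c * (1 - q) * 2 * D) * (of_real (1 - q) * (\<Sum>\<^sub>\<infinity>n. T n))"
    unfolding infsum_cmult_right' of_real_mult by (simp only: mult_ac)
  also have "\<dots> = q_dunkl_transform q \<alpha> f l"
    unfolding const q_dunkl_transform_def jackson_integral_def T_def ..
  finally show ?thesis ..
qed

end
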